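(* For $\mu,\alpha\in\mathbb{R}$ and $\varepsilon\ge 0$ consider the linear $2\pi$-periodic Hamiltonian system with Hamiltonian $$H(\xi,\eta,\tau)=\tfrac12\eta^2-\tfrac12\left[\varepsilon\cos\tau+\alpha-\tfrac{\mu}{4}\right]\xi^2 ,$$ i.e. $\xi'=\eta$, $\eta'=\left(\varepsilon\cos\tau+\alpha-\frac{\mu}{4}\right)\xi$. For each $\mu\in\mathbb{R}$, the boundary between the stability and instability regions emanating from the resonance point $\alpha=\alpha_0=\frac{\mu-9}{4}$, $\varepsilon=0$ consists of the two curves $\alpha=\alpha_{-}(\mu,\varepsilon)$ and $\alpha=\alpha_{+}(\mu,\varepsilon)$ with, as $\varepsilon\to0^+$, $$\alpha_{\mp}(\mu,\varepsilon)=\frac{\mu-9}{4}-\frac1{16}\varepsilon^2\mp\frac1{32}\varepsilon^3-\frac{13}{5120}\varepsilon^4\pm\frac{5}{2048}\varepsilon^5+\mathcal{O}(\varepsilon^6)$$ (upper signs for $\alpha_-$, lower signs for $\alpha_+$). The instability region associated with this resonance is the region between the two curves.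
   Context: The system is the linearization at the equilibrium $P_2=(\pi,0)$ of the charged pendulum with Hamiltonian $\frac12 y^2-\alpha\cos x-\varepsilon\cos\tau\cos x-\frac{\mu}{2}\log(7+\cos2x)$. A linear periodic system is stable if all its solutions are bounded for all $\tau\in\mathbb{R}$, and unstable otherwise. The point $(\mu,\alpha_0,0)$ is the resonance $2\omega=N$ with $N=3$, where $\omega^2=\frac{\mu}{4}-\alpha_0$. "The boundary emanating from $(\alpha_0,0)$ consists of the two curves $\alpha_\pm$, with instability region between them" means: there are $\varepsilon_0>0$ and $\delta>0$ (for fixed $\mu$) such that $\alpha_\pm(\mu,\cdot)$ are defined on $[0,\varepsilon_0)$, equal $\alpha_0$ at $\varepsilon=0$, and for $0<\varepsilon<\varepsilon_0$, $|\alpha-\alpha_0|<\delta$, the system is unstable when $\alpha$ lies strictly between the two curves and stable when $\alpha$ is strictly outside the closed interval they bound. As $\mu$ varies these curves form surfaces in the parameter space $(\mu,\alpha,\varepsilon)$. *)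

theory Defs
  imports "HOL-Analysis.Analysis" "HOL-Library.Landau_Symbols"
begin

definition hamiltonian_solution ::
    "(real \<Rightarrow> real \<Rightarrow> real \<Rightarrow> real) \<Rightarrow> (real \<Rightarrow> real) \<Rightarrow> (real \<Rightarrow> real) \<Rightarrow> bool" where
  "hamiltonian_solution H \<xi> \<eta> \<longleftrightarrow>
     (\<forall>\<tau>. (\<xi> has_real_derivative deriv (\<lambda>y. H (\<xi> \<tau>) y \<tau>) (\<eta> \<tau>)) (at \<tau>) \<and>
          (\<eta> has_real_derivative - deriv (\<lambda>x. H x (\<eta> \<tau>) \<tau>) (\<xi> \<tau>)) (at \<tau>))"

definition stable_system :: "(real \<Rightarrow> real \<Rightarrow> real \<Rightarrow> real) \<Rightarrow> bool" where
  "stable_system H \<longleftrightarrow>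
     (\<forall>\<xi> \<eta>. hamiltonian_solution H \<xi> \<eta> \<longrightarrow> bounded (range (\<lambda>\<tau>. (\<xi> \<tau>, \<eta> \<tau>))))"

definition pendulum_H :: "real \<Rightarrow> real \<Rightarrow> real \<Rightarrow> real \<Rightarrow> real \<Rightarrow> real \<Rightarrow> real" where
  "pendulum_H \<mu> \<alpha> \<epsilon> \<xi> \<eta> \<tau> =
     1/2 * \<eta>^2 - 1/2 * (\<epsilon> * cos \<tau> + \<alpha> - \<mu>/4) * \<xi>^2"

lemma hamiltonian_solution_pendulum_H:
  "hamiltonian_solution (pendulum_H \<mu> \<alpha> \<epsilon>) \<xi> \<eta> \<longleftrightarrow>
     (\<forall>\<tau>. (\<xi> has_real_derivative \<eta> \<tau>) (at \<tau>) \<and>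
          (\<eta> has_real_derivative (\<epsilon> * cos \<tau> + \<alpha> - \<mu>/4) * \<xi> \<tau>) (at \<tau>))"
proof -
  have "deriv (\<lambda>y. pendulum_H \<mu> \<alpha> \<epsilon> x y \<tau>) z = z" for x z \<tau>
    unfolding pendulum_H_def by (rule DERIV_imp_deriv) (auto intro!: derivative_eq_intros)
  moreover have "deriv (\<lambda>x. pendulum_H \<mu> \<alpha> \<epsilon> x y \<tau>) z = - ((\<epsilon> * cos \<tau> + \<alpha> - \<mu>/4) * z)" for y z \<tau>
    unfolding pendulum_H_def by (rule DERIV_imp_deriv) (auto intro!: derivative_eq_intros)
  ultimately show ?thesis
    unfolding hamiltonian_solution_def by simp
qed

text \<open>
  \<open>S \<alpha> \<epsilon>\<close> says that the system with parameters \<open>\<alpha>\<close>, \<open>\<epsilon>\<close> is stable.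
  Segments are used so that no order of the two curves is presupposed.
  Nothing is claimed on the curves themselves.
\<close>

definition boundary_emanating_from ::
    "(real \<Rightarrow> real \<Rightarrow> bool) \<Rightarrow> real \<Rightarrow> (real \<Rightarrow> real) \<Rightarrow> (real \<Rightarrow> real) \<Rightarrow> bool" where
  "boundary_emanating_from S \<alpha>\<^sub>0 a b \<longleftrightarrow>
     (\<exists>\<epsilon>\<^sub>0>0. \<exists>\<delta>>0.
        continuous_on {0..<\<epsilon>\<^sub>0} a \<and> continuous_on {0..<\<epsilon>\<^sub>0} b \<and>
        a 0 = \<alpha>\<^sub>0 \<and> b 0 = \<alpha>\<^sub>0 \<and>
        (\<forall>\<epsilon> \<alpha>. 0 < \<epsilon> \<and> \<epsilon> < \<epsilon>\<^sub>0 \<and> \<bar>\<alpha> - \<alpha>\<^sub>0\<bar> < \<delta> \<longrightarrow>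
           (\<alpha> \<in> open_segment (a \<epsilon>) (b \<epsilon>) \<longrightarrow> \<not> S \<alpha> \<epsilon>) \<and>
           (\<alpha> \<notin> closed_segment (a \<epsilon>) (b \<epsilon>) \<longrightarrow> S \<alpha> \<epsilon>)))"

end

theory Submission
  imports Defs
begin

text \<open>
  Write \<open>s = \<alpha> - \<mu> / 4\<close>, so that the system is \<open>x'' = (s + e * cos t) * x\<close>, and let \<open>c\<close>, \<open>d\<close> be its
  even and odd normalised solutions. Half the trace of the monodromy matrix is
  \<open>2 * c pi * d' pi - 1\<close>, and shifting time by half a period shows \<open>d' pi\<close> at \<open>e\<close> to be
  \<open>F s (- e)\<close>, where \<open>F s e = c pi\<close>. Hence near the resonance the system is stable if
  \<open>F s e * F s (- e) > 0\<close> and unstable if this product is negative. Wronskian identities show that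
  \<open>F s e / c' pi\<close> is Lipschitz and strictly decreasing in \<open>s\<close>, so \<open>F\<close> vanishes along one curve
  \<open>s = \<sigma> e\<close>, and the two boundary curves are \<open>\<sigma> e\<close> and \<open>\<sigma> (- e)\<close>. A truncated Fourier series that
  solves the equation up to \<open>O(e ^ 6)\<close> then determines \<open>\<sigma>\<close> up to \<open>O(e ^ 6)\<close>.
\<close>

section \<open>Existence of solutions of Hill's equation\<close>

definition hill_solution :: "(real \<Rightarrow> real) \<Rightarrow> (real \<Rightarrow> real) \<Rightarrow> (real \<Rightarrow> real) \<Rightarrow> bool" where
  "hill_solution Q x y \<longleftrightarrow>
     (\<forall>t. (x has_real_derivative y t) (at t) \<and> (y has_real_derivative Q t * x t) (at t))"

text \<open>Choosing an antiderivative on the whole line, normalised at 0, treats positive and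
  negative times alike. For continuous \<open>f\<close> such a function exists, which gives the
  choice its meaning.\<close>

definition antiderivative :: "(real \<Rightarrow> real) \<Rightarrow> real \<Rightarrow> real" where
  "antiderivative f = (SOME F. F 0 = 0 \<and> (\<forall>t. (F has_real_derivative f t) (at t)))"

lemma antiderivative:
  assumes "continuous_on UNIV f"
  shows "antiderivative f 0 = 0" "(antiderivative f has_real_derivative f t) (at t)"
proof -
  have "\<exists>F. \<forall>x. (-\<infinity>::ereal) < x \<longrightarrow> x < \<infinity> \<longrightarrow> (F has_vector_derivative f x) (at x)"
    by (rule einterval_antiderivative) (use assms in \<open>auto simp: continuous_on_eq_continuous_at\<close>)
  then obtain F where F: "\<And>x. (F has_real_derivative f x) (at x)"
    by (auto simp: has_real_derivative_iff_has_vector_derivative)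
  have "\<exists>F. F 0 = 0 \<and> (\<forall>t. (F has_real_derivative f t) (at t))"
    by (rule exI[of _ "\<lambda>t. F t - F 0"]) (auto intro!: derivative_eq_intros F)
  from someI_ex[OF this] show "antiderivative f 0 = 0" "(antiderivative f has_real_derivative f t) (at t)"
    unfolding antiderivative_def by auto
qed

text \<open>With \<open>?g\<close> the antiderivative of the bound, both \<open>?g - f\<close> and
  \<open>?g + f\<close> are nondecreasing on nonnegative times and vanish at 0.\<close>

lemma power_growth_nonneg:
  fixes f f' :: "real \<Rightarrow> real"
  assumes "f 0 = 0" and d: "\<And>t. (f has_real_derivative f' t) (at t)"
    and b: "\<And>t. t \<ge> 0 \<Longrightarrow> \<bar>f' t\<bar> \<le> A * t ^ n / fact n" and "0 \<le> t"
  shows "\<bar>f t\<bar> \<le> A * t ^ Suc n / fact (Suc n)"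
proof -
  let ?g = "\<lambda>t. A * t ^ Suc n / fact (Suc n)"
  have g: "(?g has_real_derivative A * t ^ n / fact n) (at t)" for t
  proof -
    have "(?g has_real_derivative A * (real (Suc n) * t ^ n) / fact (Suc n)) (at t)"
      by (rule DERIV_cdivide, rule DERIV_cmult) (use DERIV_pow[of "Suc n" t] in simp)
    moreover have "A * (real (Suc n) * t ^ n) / fact (Suc n) = A * t ^ n / fact n"
      unfolding fact_Suc of_nat_mult by (simp del: of_nat_Suc)
    ultimately show ?thesis by simp
  qed
  have "\<exists>D. ((\<lambda>t. ?g t - f t) has_real_derivative D) (at x) \<and> D \<ge> 0" if "0 \<le> x" for x
    using b[OF that] DERIV_diff[OF g d, of x] by (auto simp: abs_le_iff simp del: fact_Suc power_Suc)
  then have "?g 0 - f 0 \<le> ?g t - f t"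
    using DERIV_nonneg_imp_nondecreasing[of 0 t "\<lambda>t. ?g t - f t"] \<open>0 \<le> t\<close> by blast
  moreover have "\<exists>D. ((\<lambda>t. ?g t + f t) has_real_derivative D) (at x) \<and> D \<ge> 0" if "0 \<le> x" for x
    using b[OF that] DERIV_add[OF g d, of x] by (auto simp: abs_le_iff simp del: fact_Suc power_Suc)
  then have "?g 0 + f 0 \<le> ?g t + f t"
    using DERIV_nonneg_imp_nondecreasing[of 0 t "\<lambda>t. ?g t + f t"] \<open>0 \<le> t\<close> by blast
  ultimately show ?thesis using \<open>f 0 = 0\<close> by (simp add: abs_le_iff)
qed

text \<open>One integration raises the power and the factorial by one: the induction step behind the
  exponential majorant of the Picard series. Negative times are reduced to positive ones by
  reflection.\<close>

lemma power_growth: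
  fixes f f' :: "real \<Rightarrow> real"
  assumes "f 0 = 0" and d: "\<And>t. (f has_real_derivative f' t) (at t)"
    and b: "\<And>t. \<bar>f' t\<bar> \<le> A * \<bar>t\<bar> ^ n / fact n"
  shows "\<bar>f t\<bar> \<le> A * \<bar>t\<bar> ^ Suc n / fact (Suc n)"
proof (cases "0 \<le> t")
  case True
  then show ?thesis
    using power_growth_nonneg[of f f' A n t] assms(1) d b by (metis abs_of_nonneg)
next
  case False
  have "\<bar>f (- (- t))\<bar> \<le> A * (- t) ^ Suc n / fact (Suc n)"
  proof (rule power_growth_nonneg[of "\<lambda>t. f (- t)" "\<lambda>t. - f' (- t)"])
    show "((\<lambda>t. f (- t)) has_real_derivative - f' (- t)) (at t)" for t
      using d by (simp add: DERIV_mirror[symmetric])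
    show "\<bar>- f' (- t)\<bar> \<le> A * t ^ n / fact n" if "0 \<le> t" for t
      using b[of "- t"] that by simp
  qed (use assms(1) False in auto)
  then show ?thesis using False by simp
qed

text \<open>These are the increments of the Picard iteration, not its iterates: as the system is
  linear, the solution is the sum of all of them.\<close>

primrec picard :: "(real \<Rightarrow> real) \<Rightarrow> real \<Rightarrow> real \<Rightarrow> nat \<Rightarrow> (real \<Rightarrow> real) \<times> (real \<Rightarrow> real)" where
  "picard Q a b 0 = (\<lambda>_. a, \<lambda>_. b)"
| "picard Q a b (Suc n) =
     (antiderivative (snd (picard Q a b n)), antiderivative (\<lambda>t. Q t * fst (picard Q a b n) t))"

text \<open>Each Picard increment is dominated by a term of an exponential series, so the series and
  its termwise derivative converge uniformly on compact intervals. Differentiating termwise shifts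
  the index by one and yields the equation.\<close>

lemma hill_solution_exists:
  assumes Q: "continuous_on UNIV Q" and B: "\<And>t. \<bar>Q t\<bar> \<le> B"
  shows "\<exists>x y. hill_solution Q x y \<and> x 0 = a \<and> y 0 = b"
proof -
  define x where "x n = fst (picard Q a b n)" for n
  define y where "y n = snd (picard Q a b n)" for n
  \<comment> \<open>\<open>x' n\<close> and \<open>y' n\<close> are the derivatives of the
    increments. They are 0 at index 0 because the first increment is constant; the remaining terms
    form the shifted series.\<close>
  define x' where "x' n t = (case n of 0 \<Rightarrow> 0 | Suc m \<Rightarrow> y m t)" for n t
  define y' where "y' n t = (case n of 0 \<Rightarrow> 0 | Suc m \<Rightarrow> Q t * x m t)" for n t
  \<comment> \<open>With \<open>K\<close> at least 1, one more factor \<open>K\<close> also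
    dominates the step for \<open>x\<close>, which involves no factor \<open>Q\<close>.\<close>
  define K where "K = max B 1"
  define M where "M = max \<bar>a\<bar> \<bar>b\<bar>"
  have K: "1 \<le> K" "\<bar>Q t\<bar> \<le> K" for t using B[of t] by (auto simp: K_def)
  have M: "0 \<le> M" by (auto simp: M_def)
  have x0: "x 0 = (\<lambda>_. a)" "y 0 = (\<lambda>_. b)" by (auto simp: x_def y_def)
  have cont: "continuous_on UNIV (x n) \<and> continuous_on UNIV (y n)" for n
  proof (induction n)
    case (Suc n)
    have 1: "continuous_on UNIV (\<lambda>t. Q t * x n t)" using Suc Q by (intro continuous_intros) auto
    show ?case
      using antiderivative(2)[OF 1] antiderivative(2)[of "y n"] Suc
      by (auto intro!: DERIV_continuous_on simp: x_def y_def)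
  qed (simp add: x0)
  have cQ: "continuous_on UNIV (\<lambda>t. Q t * x n t)" for n
    using cont[of n] Q by (intro continuous_intros) auto
  have S: "x (Suc n) = antiderivative (y n)" "y (Suc n) = antiderivative (\<lambda>t. Q t * x n t)" for n
    by (auto simp: x_def y_def)
  have dx: "(x n has_real_derivative x' n t) (at t)" for n t
    using antiderivative(2)[of "y (n - 1)" t] cont by (cases n) (auto simp: x0 x'_def S)
  have dy: "(y n has_real_derivative y' n t) (at t)" for n t
    using antiderivative(2)[OF cQ[of "n - 1"]] by (cases n) (auto simp: x0 y'_def S)
  have bound: "\<bar>x n t\<bar> \<le> M * K ^ n * \<bar>t\<bar> ^ n / fact n \<and> \<bar>y n t\<bar> \<le> M * K ^ n * \<bar>t\<bar> ^ n / fact n" for n t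
  proof (induction n arbitrary: t)
    case (Suc n)
    have k: "K ^ n \<le> K ^ Suc n" using K by (intro power_increasing) auto
    have "\<bar>y n t\<bar> \<le> M * K ^ Suc n * \<bar>t\<bar> ^ n / fact n" for t
    proof -
      have "M * K ^ n * \<bar>t\<bar> ^ n / fact n \<le> M * K ^ Suc n * \<bar>t\<bar> ^ n / fact n"
        using k M by (intro divide_right_mono mult_right_mono mult_left_mono) auto
      then show ?thesis using Suc[of t] by linarith
    qed
    then have 1: "\<bar>x (Suc n) t\<bar> \<le> M * K ^ Suc n * \<bar>t\<bar> ^ Suc n / fact (Suc n)"
      using antiderivative[of "y n"] cont unfolding S
      by (intro power_growth[where f'="y n"]) auto
    have "\<bar>Q t * x n t\<bar> \<le> M * K ^ Suc n * \<bar>t\<bar> ^ n / fact n" for t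
    proof -
      have "\<bar>Q t * x n t\<bar> \<le> K * (M * K ^ n * \<bar>t\<bar> ^ n / fact n)"
        using Suc[of t] K unfolding abs_mult by (intro mult_mono) auto
      then show ?thesis by (simp add: mult_ac)
    qed
    then have 2: "\<bar>y (Suc n) t\<bar> \<le> M * K ^ Suc n * \<bar>t\<bar> ^ Suc n / fact (Suc n)"
      using antiderivative[OF cQ] unfolding S
      by (intro power_growth[where f'="\<lambda>t. Q t * x n t"]) auto
    show ?case using 1 2 by simp
  qed (auto simp: x0 M_def)
  have exps: "summable (\<lambda>n. M * K ^ n * R ^ n / fact n)" for R
    using summable_mult[OF summable_exp_generic[of "K * R"], of M]
    by (simp add: field_simps power_mult_distrib scaleR_conv_of_real)
  have sum_x: "summable (\<lambda>n. x n t)" and sum_y: "summable (\<lambda>n. y n t)" for t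
    by (rule summable_comparison_test'[OF exps[of "\<bar>t\<bar>"]]; use bound in simp)+
  have unif: "uniformly_convergent_on {-R..R} (\<lambda>n t. \<Sum>i<n. x' i t)"
    "uniformly_convergent_on {-R..R} (\<lambda>n t. \<Sum>i<n. y' i t)" for R
  proof -
    define m where "m n = (case n of 0 \<Rightarrow> 0 | Suc k \<Rightarrow> K * (M * K ^ k * R ^ k / fact k))" for n
    have sm: "summable m"
      by (rule iffD1[OF summable_Suc_iff]) (use summable_mult[OF exps, of K] in \<open>simp add: m_def\<close>)
    have le: "\<bar>x k t\<bar> \<le> M * K ^ k * R ^ k / fact k" "\<bar>y k t\<bar> \<le> M * K ^ k * R ^ k / fact k"
      if "t \<in> {-R..R}" for k t
    proof -
      have "M * K ^ k * \<bar>t\<bar> ^ k / fact k \<le> M * K ^ k * R ^ k / fact k"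
        using that M K(1) by (intro divide_right_mono mult_left_mono power_mono) auto
      then show "\<bar>x k t\<bar> \<le> M * K ^ k * R ^ k / fact k" "\<bar>y k t\<bar> \<le> M * K ^ k * R ^ k / fact k"
        using bound[where n=k and t=t] by auto
    qed
    show "uniformly_convergent_on {-R..R} (\<lambda>n t. \<Sum>i<n. x' i t)"
    proof (rule Weierstrass_m_test'[OF _ sm])
      fix n t assume t: "t \<in> {-R..R}"
      show "norm (x' n t) \<le> m n"
      proof (cases n)
        case (Suc k)
        have "1 * \<bar>y k t\<bar> \<le> K * (M * K ^ k * R ^ k / fact k)"
          using le(2)[OF t] K by (intro mult_mono) auto
        then show ?thesis using Suc by (simp add: x'_def m_def)
      qed (simp add: x'_def m_def)
    qed
    show "uniformly_convergent_on {-R..R} (\<lambda>n t. \<Sum>i<n. y' i t)"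
    proof (rule Weierstrass_m_test'[OF _ sm])
      fix n t assume t: "t \<in> {-R..R}"
      show "norm (y' n t) \<le> m n"
      proof (cases n)
        case (Suc k)
        have "\<bar>Q t\<bar> * \<bar>x k t\<bar> \<le> K * (M * K ^ k * R ^ k / fact k)"
          using le(1)[OF t] K by (intro mult_mono) auto
        then show ?thesis using Suc by (simp add: y'_def m_def abs_mult)
      qed (simp add: y'_def m_def)
    qed
  qed
  have X: "((\<lambda>t. \<Sum>n. x n t) has_real_derivative (\<Sum>n. y n t)) (at t)" for t
  proof -
    obtain R where R: "\<bar>t\<bar> < R" using gt_ex by blast
    have "((\<lambda>t. \<Sum>n. x n t) has_real_derivative (\<Sum>n. x' n t)) (at t)"
      by (rule has_field_derivative_series'(2)[where S="{-R..R}" and f'="x'" and ?x0.0=0])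
        (use unif[of R] dx sum_x R in \<open>auto simp: interior_atLeastAtMost_real intro: has_field_derivative_at_within\<close>)
    moreover have "(\<lambda>n. x' n t) sums (\<Sum>n. y n t)"
      using summable_sums[OF sum_y] sums_Suc_iff[of "\<lambda>n. x' n t" "\<Sum>n. y n t"]
      by (simp add: x'_def)
    ultimately show ?thesis by (simp add: sums_iff)
  qed
  have Y: "((\<lambda>t. \<Sum>n. y n t) has_real_derivative Q t * (\<Sum>n. x n t)) (at t)" for t
  proof -
    obtain R where R: "\<bar>t\<bar> < R" using gt_ex by blast
    have "((\<lambda>t. \<Sum>n. y n t) has_real_derivative (\<Sum>n. y' n t)) (at t)"
      by (rule has_field_derivative_series'(2)[where S="{-R..R}" and f'="y'" and ?x0.0=0])
        (use unif[of R] dy sum_y R in \<open>auto simp: interior_atLeastAtMost_real intro: has_field_derivative_at_within\<close>)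
    moreover have "(\<lambda>n. y' n t) sums (Q t * (\<Sum>n. x n t))"
      using sums_mult[OF summable_sums[OF sum_x], of "Q t"] sums_Suc_iff[of "\<lambda>n. y' n t" "Q t * (\<Sum>n. x n t)"]
      by (simp add: y'_def)
    ultimately show ?thesis by (simp add: sums_iff)
  qed
  have zero: "x (Suc n) 0 = 0" "y (Suc n) 0 = 0" for n
    using antiderivative(1)[OF cQ] antiderivative(1)[of "y n"] cont unfolding S by auto
  have "(\<Sum>n. x n 0) = a" "(\<Sum>n. y n 0) = b"
    using suminf_split_head[OF sum_x[of 0]] suminf_split_head[OF sum_y[of 0]] by (simp_all add: zero x0)
  then show ?thesis using X Y unfolding hill_solution_def
    by (intro exI[of _ "\<lambda>t. \<Sum>n. x n t"] exI[of _ "\<lambda>t. \<Sum>n. y n t"]) simp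
qed

section \<open>Floquet theory for even coefficients\<close>

lemma hill_wronskian:
  assumes "hill_solution Q x y" "hill_solution Q u v"
  shows "x t * v t - u t * y t = x s * v s - u s * y s"
proof -
  have "((\<lambda>t. x t * v t - u t * y t) has_real_derivative 0) (at t)" for t
    using assms unfolding hill_solution_def
    by (auto intro!: derivative_eq_intros simp: algebra_simps)
  then show ?thesis using DERIV_const_ratio_const DERIV_isconst_all by blast
qed

text \<open>The Wronskians of \<open>x\<close> with \<open>c\<close> and \<open>d\<close> keep their
  values from time 0, and solving for \<open>x\<close> and \<open>y\<close> is Cramer's rule with
  determinant 1. In particular the initial values determine a solution.\<close>

lemma hill_expand:
  assumes c: "hill_solution Q c c'" "c 0 = 1" "c' 0 = 0"
    and d: "hill_solution Q d d'" "d 0 = 0" "d' 0 = 1"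
    and x: "hill_solution Q x y"
  shows "x t = x 0 * c t + y 0 * d t" "y t = x 0 * c' t + y 0 * d' t"
proof -
  have w: "c t * d' t - d t * c' t = 1" "x t * d' t - d t * y t = x 0" "c t * y t - x t * c' t = y 0"
    using hill_wronskian[OF c(1) d(1), of t 0] hill_wronskian[OF x d(1), of t 0]
      hill_wronskian[OF c(1) x, of t 0] c d by auto
  have "x 0 * c t + y 0 * d t = x t * (c t * d' t - d t * c' t)"
    "x 0 * c' t + y 0 * d' t = y t * (c t * d' t - d t * c' t)"
    unfolding w(2,3)[symmetric] by algebra+
  then show "x t = x 0 * c t + y 0 * d t" "y t = x 0 * c' t + y 0 * d' t" by (simp_all add: w(1))
qed

lemma hill_shift:
  assumes "hill_solution Q x y"
  shows "hill_solution (\<lambda>t. Q (t + p)) (\<lambda>t. x (t + p)) (\<lambda>t. y (t + p))"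
  using assms by (auto simp: hill_solution_def intro!: iffD1[OF DERIV_shift])

lemma hill_reflect:
  assumes "hill_solution Q x y"
  shows "hill_solution (\<lambda>t. Q (- t)) (\<lambda>t. x (- t)) (\<lambda>t. - y (- t))"
proof -
  have x: "(x has_real_derivative y s) (at s)" and y: "(y has_real_derivative Q s * x s) (at s)" for s
    using assms unfolding hill_solution_def by auto
  show ?thesis unfolding hill_solution_def
    using x y DERIV_minus[OF iffD1[OF DERIV_mirror, OF y]] by (auto simp: DERIV_mirror[symmetric])
qed

text \<open>The trace of the monodromy matrix is \<open>2 * a\<close>, with \<open>a = 2 * c pi * d' pi - 1\<close>.\<close>

lemma hill_two_periods:
  assumes per: "\<And>t. Q (t + 2 * pi) = Q t" and even: "\<And>t. Q (- t) = Q t"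
    and c: "hill_solution Q c c'" "c 0 = 1" "c' 0 = 0"
    and d: "hill_solution Q d d'" "d 0 = 0" "d' 0 = 1"
    and x: "hill_solution Q x y"
    and a: "a = 2 * c pi * d' pi - 1"
  shows "x (t + 4 * pi) = 2 * a * x (t + 2 * pi) - x t" "y (t + 4 * pi) = 2 * a * y (t + 2 * pi) - y t"
    "c (2 * pi) = a"
proof -
  note expand = hill_expand[OF c d]
  \<comment> \<open>As \<open>Q\<close> is even, reflecting a solution gives another one; comparing
    initial values makes \<open>c\<close> even and \<open>d\<close> odd.\<close>
  have cr: "c (- t) = c t" "c' (- t) = - c' t" for t
    using expand[OF hill_reflect[OF c(1), unfolded even], of t] c by auto
  have dr: "d (- t) = - d t" "d' (- t) = d' t" for t
    using expand[OF hill_reflect[OF d(1), unfolded even], of t] d by auto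
  note sh = hill_shift[where p="2*pi" and Q=Q, unfolded per]
  note cs = expand[OF sh[OF c(1)], simplified]
  note ds = expand[OF sh[OF d(1)], simplified]
  have w: "c t * d' t - d t * c' t = 1" for t
    using hill_wronskian[OF c(1) d(1), of t 0] c d by auto
  \<comment> \<open>Evaluating the solutions shifted by a period at \<open>-pi\<close> and using
    parity links the monodromy entries to the values at \<open>pi\<close>. Together with the
    Wronskian this gives both diagonal entries.\<close>
  have "c pi = c (2*pi) * c pi - c' (2*pi) * d pi" "c' pi = - c (2*pi) * c' pi + c' (2*pi) * d' pi"
    "d pi = d (2*pi) * c pi - d' (2*pi) * d pi" "d' pi = - d (2*pi) * c' pi + d' (2*pi) * d' pi"
    using cs(1)[of "-pi"] cs(2)[of "-pi"] ds(1)[of "-pi"] ds(2)[of "-pi"] by (simp_all add: cr dr)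
  with w[of pi] have "c (2*pi) = 2 * c pi * d' pi - 1" "d' (2*pi) = 2 * c pi * d' pi - 1" by algebra+
  then have a2: "c (2*pi) = a" "d' (2*pi) = a" using a by auto
  have X: "x (s + 2*pi) = x (2*pi) * c s + y (2*pi) * d s"
    "y (s + 2*pi) = x (2*pi) * c' s + y (2*pi) * d' s" for s
    using expand[OF sh[OF x]] by simp_all
  have x0: "x s = x 0 * c s + y 0 * d s" "y s = x 0 * c' s + y 0 * d' s" for s
    by (rule expand[OF x])+
  have four: "4 * pi = 2 * pi + 2 * pi" by simp
  \<comment> \<open>The monodromy matrix has determinant 1 and both diagonal entries
    \<open>a\<close>, so these entries of its square express Cayley-Hamilton: the square is
    \<open>2 * a\<close> times the matrix minus the identity.\<close>
  have 4: "c' (4*pi) = 2 * a * c' (2*pi)" "c (4*pi) = 2 * a * a - 1"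
     "d (4*pi) = 2 * a * d (2*pi)" "d' (4*pi) = 2 * a * a - 1"
    using cs[of "2*pi", folded four] ds[of "2*pi", folded four] w[of "2*pi"] a2 by algebra+
  have sh4: "hill_solution Q (\<lambda>t. x (t + 4*pi)) (\<lambda>t. y (t + 4*pi))"
    using sh[OF sh[OF x]] by (simp add: algebra_simps)
  have "x (t + 4 * pi) = x (4*pi) * c t + y (4*pi) * d t"
    "y (t + 4 * pi) = x (4*pi) * c' t + y (4*pi) * d' t"
    using expand[OF sh4, of t] by simp_all
  then show "x (t + 4 * pi) = 2 * a * x (t + 2 * pi) - x t" "y (t + 4 * pi) = 2 * a * y (t + 2 * pi) - y t"
    unfolding X using x0[of "4*pi"] x0[of "2*pi"] x0[of t] a2 4 by algebra+
  show "c (2 * pi) = a" by fact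
qed

lemma bounded_of_two_periods:
  fixes x :: "real \<Rightarrow> real"
  assumes cont: "continuous_on UNIV x" and "p > 0"
    and rec: "\<And>t. x (t + 2 * p) = 2 * a * x (t + p) - x t" and a: "\<bar>a\<bar> < 1"
  shows "bounded (range x)"
proof -
  \<comment> \<open>The quadratic form preserved by the recurrence; it is definite because \<open>\<bar>a\<bar> < 1\<close>.\<close>
  define J where "J t = (x (t + p))\<^sup>2 - 2 * a * x t * x (t + p) + (x t)\<^sup>2" for t
  have per: "J (t + p) = J t" for t
  proof -
    have "x (t + p + p) = 2 * a * x (t + p) - x t" using rec[of t] by (simp add: algebra_simps)
    then show ?thesis unfolding J_def by algebra
  qed
  have pern: "J (t + real n * p) = J t" for t n
  proof (induction n)
    case (Suc n)
    then show ?case using per[of "t + real n * p"] by (simp add: algebra_simps)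
  qed simp
  have peri: "J (t - of_int k * p) = J t" for t k
  proof (cases "k \<ge> 0")
    case True
    then show ?thesis using pern[of "t - of_int k * p" "nat k"] by simp
  next
    case False
    then show ?thesis using pern[of t "nat (- k)"] by simp
  qed
  have "continuous_on {0..p} J" unfolding J_def
    by (intro continuous_intros continuous_on_compose2[OF cont]) auto
  then have "bounded (J ` {0..p})" by (intro compact_imp_bounded compact_continuous_image) auto
  then obtain M where M: "\<And>t. t \<in> {0..p} \<Longrightarrow> \<bar>J t\<bar> \<le> M" unfolding bounded_iff by fastforce
  have "(1 - a\<^sup>2) * (x t)\<^sup>2 \<le> M" for t
  proof -
    define k where "k = \<lfloor>t / p\<rfloor>"
    have "of_int k \<le> t / p" "t / p < of_int k + 1" unfolding k_def by linarith+
    then have "t - of_int k * p \<in> {0..p}" using \<open>p > 0\<close> by (auto simp: field_simps)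
    from M[OF this] have "J t \<le> M" by (simp add: peri)
    moreover have "J t = (x (t + p) - a * x t)\<^sup>2 + (1 - a\<^sup>2) * (x t)\<^sup>2"
      by (simp add: J_def power2_eq_square algebra_simps)
    ultimately show ?thesis by (smt (verit) zero_le_power2)
  qed
  moreover have a2: "0 < 1 - a\<^sup>2" using a by (simp add: abs_square_less_1)
  ultimately have x2: "(x t)\<^sup>2 \<le> M / (1 - a\<^sup>2)" for t by (simp add: field_simps)
  show ?thesis unfolding bounded_iff
    using real_le_rsqrt[OF x2] real_sqrt_le_mono[OF x2] by auto
qed

text \<open>The sequence consists of the Chebyshev values \<open>T_n(a)\<close>. Inductively each
  step multiplies the modulus by at least \<open>\<bar>a\<bar>\<close>: the subtracted term
  \<open>x n\<close> is no larger than \<open>a * x (n + 1)\<close>, which leaves at least one of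
  the two copies of the latter.\<close>

lemma two_term_recurrence_growth:
  fixes x :: "nat \<Rightarrow> real"
  assumes "\<And>n. x (n + 2) = 2 * a * x (n + 1) - x n" "x 0 = 1" "x 1 = a" "\<bar>a\<bar> \<ge> 1"
  shows "\<bar>a\<bar> ^ n \<le> \<bar>x n\<bar>"
proof -
  have step: "\<bar>a\<bar> * \<bar>x n\<bar> \<le> \<bar>x (Suc n)\<bar>" for n
  proof (induction n)
    case (Suc n)
    have "\<bar>x n\<bar> \<le> \<bar>a\<bar> * \<bar>x n\<bar>" using assms(4) by (simp add: mult_le_cancel_right1)
    also note Suc
    also have "\<bar>x (Suc n)\<bar> \<le> \<bar>a\<bar> * \<bar>x (Suc n)\<bar>" using assms(4) by (simp add: mult_le_cancel_right1)
    finally have "\<bar>a\<bar> * \<bar>x (Suc n)\<bar> \<le> \<bar>2 * a * x (Suc n)\<bar> - \<bar>x n\<bar>" by (simp add: abs_mult)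
    also have "\<dots> \<le> \<bar>x (Suc (Suc n))\<bar>" using assms(1)[of n] by simp
    finally show ?case .
  qed (use assms in simp)
  show ?thesis
  proof (induction n)
    case (Suc n)
    have "\<bar>a\<bar> ^ Suc n \<le> \<bar>a\<bar> * \<bar>x n\<bar>" using Suc by (simp add: mult_left_mono)
    then show ?case using step[of n] by linarith
  qed (use assms in simp)
qed

section \<open>The Mathieu equation\<close>

definition mathieu_solution :: "real \<Rightarrow> real \<Rightarrow> (real \<Rightarrow> real) \<Rightarrow> (real \<Rightarrow> real) \<Rightarrow> bool" where
  "mathieu_solution s e = hill_solution (\<lambda>t. s + e * cos t)"

lemma mathieu_solution_exists: "\<exists>x y. mathieu_solution s e x y \<and> x 0 = a \<and> y 0 = b"
  unfolding mathieu_solution_def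
proof (rule hill_solution_exists)
  show "continuous_on UNIV (\<lambda>t. s + e * cos t)" by (intro continuous_intros)
  show "\<bar>s + e * cos t\<bar> \<le> \<bar>s\<bar> + \<bar>e\<bar>" for t
  proof -
    have "\<bar>e * cos t\<bar> \<le> \<bar>e\<bar> * 1" unfolding abs_mult by (intro mult_left_mono) auto
    then show ?thesis by linarith
  qed
qed

definition mathieu_cos :: "real \<Rightarrow> real \<Rightarrow> (real \<Rightarrow> real) \<times> (real \<Rightarrow> real)" where
  "mathieu_cos s e =
     (SOME p. mathieu_solution s e (fst p) (snd p) \<and> fst p 0 = 1 \<and> snd p 0 = 0)"

lemma mathieu_cos:
  "mathieu_solution s e (fst (mathieu_cos s e)) (snd (mathieu_cos s e))"
  "fst (mathieu_cos s e) 0 = 1" "snd (mathieu_cos s e) 0 = 0"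
proof -
  have "\<exists>p. mathieu_solution s e (fst p) (snd p) \<and> fst p 0 = 1 \<and> snd p 0 = 0"
    using mathieu_solution_exists[of s e 1 0] by auto
  from someI_ex[OF this]
  show "mathieu_solution s e (fst (mathieu_cos s e)) (snd (mathieu_cos s e))"
    "fst (mathieu_cos s e) 0 = 1" "snd (mathieu_cos s e) 0 = 0"
    unfolding mathieu_cos_def by auto
qed

definition cos_end :: "real \<Rightarrow> real \<Rightarrow> real" where
  "cos_end s e = fst (mathieu_cos s e) pi"

definition cos_end_deriv :: "real \<Rightarrow> real \<Rightarrow> real" where
  "cos_end_deriv s e = snd (mathieu_cos s e) pi"

text \<open>Shifting time by \<open>pi\<close> turns \<open>e\<close> into \<open>-e\<close>, and moves the solution that is even about \<open>0\<close>
  to one that is even about \<open>pi\<close>.\<close>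

lemma mathieu_sin_end:
  assumes d: "mathieu_solution s e d d'" "d 0 = 0" "d' 0 = 1"
  shows "d' pi = cos_end s (- e)"
proof -
  obtain c c' where c: "mathieu_solution s (- e) c c'" "c 0 = 1" "c' 0 = 0" "cos_end s (- e) = c pi"
    using mathieu_cos[of s "- e"] unfolding cos_end_def by blast
  obtain f f' where f: "mathieu_solution s (- e) f f'" "f 0 = 0" "f' 0 = 1"
    using mathieu_solution_exists by blast
  have "hill_solution (\<lambda>t. s + (- e) * cos (- t)) (\<lambda>t. c (- t)) (\<lambda>t. - c' (- t))"
    using hill_reflect[OF c(1)[unfolded mathieu_solution_def]] .
  then have "mathieu_solution s (- e) (\<lambda>t. c (- t)) (\<lambda>t. - c' (- t))"
    by (simp add: mathieu_solution_def)
  from hill_expand(1)[OF c(1)[unfolded mathieu_solution_def] c(2,3)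
      f(1)[unfolded mathieu_solution_def] f(2,3) this[unfolded mathieu_solution_def], of pi]
  have even: "c (- pi) = c pi" using c by simp
  have "hill_solution (\<lambda>t. s + (- e) * cos (t + - pi)) (\<lambda>t. c (t + - pi)) (\<lambda>t. c' (t + - pi))"
    using hill_shift[OF c(1)[unfolded mathieu_solution_def]] .
  then have "hill_solution (\<lambda>t. s + e * cos t) (\<lambda>t. c (t - pi)) (\<lambda>t. c' (t - pi))" by simp
  \<comment> \<open>The Wronskian of \<open>d\<close> with the shifted solution is
    \<open>- d' pi\<close> at \<open>pi\<close> and \<open>- c (- pi)\<close> at 0; evenness of
    \<open>c\<close> finishes.\<close>
  from hill_wronskian[OF d(1)[unfolded mathieu_solution_def] this, of pi 0] show ?thesis
    using c d even by simp
qed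

lemma hamiltonian_solution_iff_mathieu:
  "hamiltonian_solution (pendulum_H \<mu> \<alpha> e) x y \<longleftrightarrow> mathieu_solution (\<alpha> - \<mu> / 4) e x y"
  by (simp add: hamiltonian_solution_pendulum_H mathieu_solution_def hill_solution_def algebra_simps)

lemma mathieu_two_periods:
  assumes x: "mathieu_solution s e x y"
  defines "a \<equiv> 2 * cos_end s e * cos_end s (- e) - 1"
  shows "x (t + 4 * pi) = 2 * a * x (t + 2 * pi) - x t" "y (t + 4 * pi) = 2 * a * y (t + 2 * pi) - y t"
    "fst (mathieu_cos s e) (2 * pi) = a"
proof -
  obtain d d' where d: "mathieu_solution s e d d'" "d 0 = 0" "d' 0 = 1"
    using mathieu_solution_exists by blast
  have "a = 2 * fst (mathieu_cos s e) pi * d' pi - 1"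
    using mathieu_sin_end[OF d] by (simp add: a_def cos_end_def)
  from hill_two_periods[OF _ _ mathieu_cos[unfolded mathieu_solution_def]
      d[unfolded mathieu_solution_def] x[unfolded mathieu_solution_def] this]
  show "x (t + 4 * pi) = 2 * a * x (t + 2 * pi) - x t" "y (t + 4 * pi) = 2 * a * y (t + 2 * pi) - y t"
    "fst (mathieu_cos s e) (2 * pi) = a"
    by simp_all
qed

text \<open>The two bounds place the half trace \<open>a\<close> strictly between -1 and 1. Position
  and velocity both obey the two-period recurrence, so each is bounded.\<close>

lemma stable_system_pendulum:
  assumes "0 < cos_end s e * cos_end s (- e)" "cos_end s e * cos_end s (- e) < 1"
    and s: "s = \<alpha> - \<mu> / 4"
  shows "stable_system (pendulum_H \<mu> \<alpha> e)"
  unfolding stable_system_def hamiltonian_solution_iff_mathieu s[symmetric]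
proof (intro allI impI)
  fix x y assume x: "mathieu_solution s e x y"
  define a where "a = 2 * cos_end s e * cos_end s (- e) - 1"
  have a: "\<bar>a\<bar> < 1" using assms unfolding a_def by (simp add: abs_less_iff)
  have D: "(x has_real_derivative y t) (at t)" "(y has_real_derivative (s + e * cos t) * x t) (at t)" for t
    using x by (auto simp: mathieu_solution_def hill_solution_def)
  have cont: "continuous_on UNIV x" "continuous_on UNIV y"
    by (rule DERIV_continuous_on, rule has_field_derivative_at_within, rule D)+
  have "bounded (range x)"
    by (rule bounded_of_two_periods[OF cont(1), where p="2*pi" and a=a])
      (use a mathieu_two_periods(1)[OF x, folded a_def] in simp_all)
  moreover have "bounded (range y)"
    by (rule bounded_of_two_periods[OF cont(2), where p="2*pi" and a=a])
      (use a mathieu_two_periods(2)[OF x, folded a_def] in simp_all)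
  ultimately have "bounded (range x \<times> range y)" by (rule bounded_Times)
  then show "bounded (range (\<lambda>\<tau>. (x \<tau>, y \<tau>)))" by (rule bounded_subset) auto
qed

text \<open>A negative product makes the half trace less than -1, and then the even solution grows
  geometrically along multiples of \<open>2 * pi\<close>.\<close>

lemma not_stable_system_pendulum:
  assumes neg: "cos_end s e * cos_end s (- e) < 0" and s: "s = \<alpha> - \<mu> / 4"
  shows "\<not> stable_system (pendulum_H \<mu> \<alpha> e)"
proof
  assume stable: "stable_system (pendulum_H \<mu> \<alpha> e)"
  define a where "a = 2 * cos_end s e * cos_end s (- e) - 1"
  define c where "c = fst (mathieu_cos s e)"
  have a: "1 < \<bar>a\<bar>" using neg unfolding a_def by simp
  have "bounded (range (\<lambda>t. (c t, snd (mathieu_cos s e) t)))"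
    using stable mathieu_cos(1)[of s e]
    unfolding stable_system_def hamiltonian_solution_iff_mathieu s[symmetric] c_def by blast
  then have "bounded (fst ` range (\<lambda>t. (c t, snd (mathieu_cos s e) t)))" by (rule bounded_fst)
  then obtain M where M: "\<And>t. \<bar>c t\<bar> \<le> M" unfolding bounded_iff by auto
  have "\<bar>a\<bar> ^ n \<le> \<bar>c (real n * (2 * pi))\<bar>" for n
  proof (rule two_term_recurrence_growth[where x="\<lambda>n. c (real n * (2 * pi))"])
    show "c (real (n + 2) * (2 * pi)) = 2 * a * c (real (n + 1) * (2 * pi)) - c (real n * (2 * pi))" for n
      using mathieu_two_periods(1)[OF mathieu_cos(1), of s e "real n * (2 * pi)"]
      by (simp add: a_def c_def algebra_simps)
  qed (use mathieu_two_periods(3)[OF mathieu_cos(1)] a in \<open>auto simp: mathieu_cos(2) a_def c_def\<close>)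
  moreover obtain n where "M < \<bar>a\<bar> ^ n" using real_arch_pow[OF a] by blast
  ultimately show False using M by (meson linorder_not_less order_trans)
qed

section \<open>Estimates near the resonance\<close>

lemma deriv_increment_bound:
  fixes f f' :: "real \<Rightarrow> real"
  assumes d: "\<And>t. (f has_real_derivative f' t) (at t)"
    and b: "\<And>u. 0 \<le> u \<Longrightarrow> u \<le> t \<Longrightarrow> \<bar>f' u\<bar> \<le> K" and t: "0 \<le> t"
  shows "\<bar>f t - f 0\<bar> \<le> K * t"
proof (cases "t = 0")
  case False
  then obtain z where "0 < z" "z < t" "f t - f 0 = (t - 0) * f' z"
    using MVT2[of 0 t f f'] t d by auto
  then show ?thesis using b[of z] t by (simp add: abs_mult mult.commute mult_left_mono)
qed simp

text \<open>This is the perturbation tool: solutions of two different Hill equations are compared by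
  integrating the drift of their Wronskian.\<close>

lemma hill_wronskian_deriv:
  assumes "hill_solution Q x y" "hill_solution P u v"
  shows "((\<lambda>t. x t * v t - u t * y t) has_real_derivative (P t - Q t) * (x t * u t)) (at t)"
  using assms unfolding hill_solution_def
  by (auto intro!: derivative_eq_intros simp: algebra_simps)

text \<open>An a priori bound from the energy \<open>E\<close> of the unperturbed oscillator with
  frequency 3/2. Since \<open>E\<close> has derivative \<open>2 * x * y * (Q + 9/4)\<close> and
  \<open>\<bar>2 * x * y\<bar>\<close> is at most \<open>E\<close>, it grows at most like
  \<open>exp (t / 4)\<close>, hence by a factor below 3 up to time \<open>pi\<close>.\<close>

lemma near_resonance_energy:
  assumes x: "hill_solution Q x y" "x 0 = 1" "y 0 = 0"
    and Q: "\<And>t. \<bar>Q t + 9/4\<bar> \<le> 1/4" and t: "0 \<le> t" "t \<le> pi"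
  shows "\<bar>x t\<bar> \<le> 2"
proof -
  define E where "E t = (y t)\<^sup>2 + 9/4 * (x t)\<^sup>2" for t
  have D: "(x has_real_derivative y t) (at t)" "(y has_real_derivative Q t * x t) (at t)" for t
    using x by (auto simp: hill_solution_def)
  define E' where "E' t = (2 * x t * y t * (Q t + 9/4) - E t / 4) * exp (- t / 4)" for t
  have dE: "((\<lambda>t. E t * exp (- t / 4)) has_real_derivative E' t) (at t)" for t
    unfolding E_def E'_def
    by (auto intro!: derivative_eq_intros D simp: field_simps power2_eq_square)
  have "E' t \<le> 0" for t
  proof -
    have "2 * x t * y t \<le> E t" "- (2 * x t * y t) \<le> E t"
      using zero_le_power2[of "x t - y t"] zero_le_power2[of "x t + y t"] zero_le_power2[of "x t"]
      unfolding power2_diff power2_sum E_def by linarith+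
    then have "\<bar>2 * x t * y t\<bar> \<le> E t" by linarith
    then have "\<bar>2 * x t * y t * (Q t + 9/4)\<bar> \<le> E t * (1/4)"
      unfolding abs_mult[of "2 * x t * y t"] using Q by (intro mult_mono) auto
    then have "2 * x t * y t * (Q t + 9/4) - E t / 4 \<le> 0" by linarith
    then show ?thesis unfolding E'_def by (intro mult_nonpos_nonneg) auto
  qed
  then have "E t * exp (- t / 4) \<le> E 0 * exp (- 0 / 4)"
    using DERIV_nonpos_imp_nonincreasing[of 0 t "\<lambda>t. E t * exp (- t / 4)"] dE t by blast
  then have "E t \<le> 9/4 * exp (t / 4)" using x by (simp add: E_def exp_minus field_simps)
  also have "exp (t / 4) \<le> exp 1" using t pi_less_4 by (subst exp_le_cancel_iff) linarith
  also have "\<dots> \<le> 3" by (rule exp_le)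
  finally have "(x t)\<^sup>2 \<le> 4" using zero_le_power2[of "y t"] unfolding E_def by linarith
  then show ?thesis using abs_le_square_iff[of "x t" 2] by simp
qed

text \<open>Variation of constants: the Wronskians of \<open>x\<close> with
  \<open>cos (3/2 * t)\<close> and \<open>sin (3/2 * t)\<close> drift at rate at most
  \<open>2 * \<kappa>\<close>, so by at most \<open>8 * \<kappa>\<close> up to
  \<open>pi < 4\<close>.\<close>

lemma near_resonance:
  assumes x: "hill_solution Q x y" "x 0 = 1" "y 0 = 0"
    and Q: "\<And>t. \<bar>Q t + 9/4\<bar> \<le> \<kappa>" and k: "\<kappa> \<le> 1/4" and t: "0 \<le> t" "t \<le> pi"
  shows "\<bar>x t - cos (3/2 * t)\<bar> \<le> 11 * \<kappa>" "\<bar>y t + 3/2 * sin (3/2 * t)\<bar> \<le> 16 * \<kappa>"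
proof -
  have k0: "0 \<le> \<kappa>" using Q[of 0] by linarith
  have bx: "\<bar>x u\<bar> \<le> 2" if "0 \<le> u" "u \<le> t" for u
    using near_resonance_energy[OF x] Q k that t by (meson order_trans)
  have est: "\<bar>(x t * l' t - l t * y t) - (x 0 * l' 0 - l 0 * y 0)\<bar> \<le> 8 * \<kappa>"
    if l: "hill_solution (\<lambda>_. -9/4) l l'" and b: "\<And>u. \<bar>l u\<bar> \<le> 1" for l l'
  proof -
    have "\<bar>(x t * l' t - l t * y t) - (x 0 * l' 0 - l 0 * y 0)\<bar> \<le> (2 * \<kappa>) * t"
    proof (rule deriv_increment_bound[OF hill_wronskian_deriv[OF x(1) l] _ t(1)])
      fix u assume u: "0 \<le> u" "u \<le> t"
      have q: "\<bar>- 9 / 4 - Q u\<bar> \<le> \<kappa>" using Q[of u] by linarith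
      have "\<bar>(- 9 / 4 - Q u) * (x u * l u)\<bar> \<le> \<kappa> * (2 * 1)"
        unfolding abs_mult by (intro mult_mono q bx b u k0) auto
      then show "\<bar>(- 9 / 4 - Q u) * (x u * l u)\<bar> \<le> 2 * \<kappa>" by simp
    qed
    also have "\<dots> \<le> (2 * \<kappa>) * 4" using t pi_less_4 k0 by (intro mult_left_mono) auto
    finally show ?thesis by simp
  qed
  define C where "C = cos (3/2 * t)"
  define S where "S = sin (3/2 * t)"
  have CS: "C * C + S * S = 1" "\<bar>C\<bar> \<le> 1" "\<bar>S\<bar> \<le> 1"
    unfolding C_def S_def using sin_cos_squared_add3 by auto
  have "hill_solution (\<lambda>_. -9/4) (\<lambda>t. cos (3/2 * t)) (\<lambda>t. - (3/2) * sin (3/2 * t))"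
    "hill_solution (\<lambda>_. -9/4) (\<lambda>t. sin (3/2 * t)) (\<lambda>t. 3/2 * cos (3/2 * t))"
    unfolding hill_solution_def by (auto intro!: derivative_eq_intros)
  from est[OF this(1)] est[OF this(2)]
  have w: "\<bar>3/2 * x t * S + C * y t\<bar> \<le> 8 * \<kappa>" "\<bar>3/2 * x t * C - S * y t - 3/2\<bar> \<le> 8 * \<kappa>"
    unfolding C_def S_def using x by (auto simp: algebra_simps abs_minus_commute abs_le_iff)
  define U where "U = 3/2 * x t * S + C * y t"
  define V where "V = 3/2 * x t * C - S * y t - 3/2"
  have UV: "\<bar>U * a\<bar> \<le> 8 * \<kappa>" "\<bar>V * a\<bar> \<le> 8 * \<kappa>" if "\<bar>a\<bar> \<le> 1" for a
    using mult_mono[OF w(1) that] mult_mono[OF w(2) that] k0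
    by (auto simp: abs_mult U_def V_def)
  \<comment> \<open>A rotation recovers the two errors from the Wronskian errors \<open>U\<close>
    and \<open>V\<close>. Each is at most \<open>16 * \<kappa>\<close>; the constant 11 rounds up
    32/3.\<close>
  have "3/2 * (x t - C) = V * C + U * S" "y t + 3/2 * S = U * C - V * S"
    unfolding U_def V_def using CS(1) by algebra+
  with UV[OF CS(2)] UV[OF CS(3)] have "\<bar>3/2 * (x t - C)\<bar> \<le> 16 * \<kappa>" "\<bar>y t + 3/2 * S\<bar> \<le> 16 * \<kappa>"
    by linarith+
  then show "\<bar>x t - cos (3/2 * t)\<bar> \<le> 11 * \<kappa>" "\<bar>y t + 3/2 * sin (3/2 * t)\<bar> \<le> 16 * \<kappa>"
    unfolding C_def S_def using k0 by auto
qed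

text \<open>Frequency 3/2 corresponds to \<open>s = -9/4\<close>. The radii keep the whole
  coefficient within 1/500 of that value, so the constants 11 and 16 of
  \<open>near_resonance\<close> give errors below 1/40 and 1/20.\<close>

definition near_resonance_point :: "real \<Rightarrow> real \<Rightarrow> bool" where
  "near_resonance_point s e \<longleftrightarrow> \<bar>s + 9/4\<bar> \<le> 1/1000 \<and> \<bar>e\<bar> \<le> 1/1000"

lemma cos_three_halves_pi: "cos (3/2 * pi) = 0" "sin (3/2 * pi) = -1"
proof -
  have e: "3/2 * pi = pi + pi/2" by simp
  show "cos (3/2 * pi) = 0" "sin (3/2 * pi) = -1" unfolding e cos_add sin_add by simp_all
qed

lemma mathieu_cos_near:
  assumes "near_resonance_point s e" "0 \<le> t" "t \<le> pi"
  shows "\<bar>fst (mathieu_cos s e) t\<bar> \<le> 2" "\<bar>fst (mathieu_cos s e) t - cos (3/2 * t)\<bar> \<le> 1/40"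
    "\<bar>snd (mathieu_cos s e) t + 3/2 * sin (3/2 * t)\<bar> \<le> 1/20"
proof -
  have "\<bar>s + e * cos u + 9/4\<bar> \<le> 1/500" for u
  proof -
    have "\<bar>e * cos u\<bar> \<le> 1/1000 * 1"
      unfolding abs_mult using assms by (intro mult_mono) (auto simp: near_resonance_point_def)
    then show ?thesis using assms unfolding near_resonance_point_def by linarith
  qed
  note n = this near_resonance[OF mathieu_cos[unfolded mathieu_solution_def] this _ assms(2,3)]
  show "\<bar>fst (mathieu_cos s e) t - cos (3/2 * t)\<bar> \<le> 1/40"
    "\<bar>snd (mathieu_cos s e) t + 3/2 * sin (3/2 * t)\<bar> \<le> 1/20"
    using n(2,3) by auto
  have "\<bar>cos (3/2 * t)\<bar> \<le> 1" by simp
  with n(2) show "\<bar>fst (mathieu_cos s e) t\<bar> \<le> 2" by linarith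
qed

text \<open>At \<open>pi\<close> the unperturbed solution \<open>cos (3/2 * t)\<close> has value 0
  and slope 3/2. The lower bound on the slope makes division by it harmless.\<close>

lemma cos_end_near:
  assumes "near_resonance_point s e"
  shows "\<bar>cos_end s e\<bar> \<le> 1/40" "1 \<le> cos_end_deriv s e" "cos_end_deriv s e \<le> 2"
  using mathieu_cos_near(2,3)[OF assms pi_ge_zero order_refl]
  unfolding cos_three_halves_pi cos_end_def cos_end_deriv_def by linarith+

text \<open>Unlike \<open>cos_end\<close>, this ratio can be compared at different parameters by a single Wronskian:
  the numerator of a difference of ratios is the Wronskian of the two solutions at \<open>pi\<close>.\<close>

definition cos_end_ratio :: "real \<Rightarrow> real \<Rightarrow> real" where
  "cos_end_ratio s e = cos_end s e / cos_end_deriv s e"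

lemma cos_end_ratio_sign:
  assumes "near_resonance_point s e"
  shows "cos_end s e > 0 \<longleftrightarrow> cos_end_ratio s e > 0" "cos_end s e < 0 \<longleftrightarrow> cos_end_ratio s e < 0"
  using cos_end_near[OF assms] by (auto simp: cos_end_ratio_def field_simps)

lemma cos_end_ratio_diff:
  assumes "near_resonance_point s e" "near_resonance_point s' e'"
  shows "cos_end_ratio s e - cos_end_ratio s' e' =
    (cos_end s e * cos_end_deriv s' e' - cos_end s' e' * cos_end_deriv s e) /
    (cos_end_deriv s e * cos_end_deriv s' e')"
  using cos_end_near[OF assms(1)] cos_end_near[OF assms(2)]
  by (simp add: cos_end_ratio_def field_simps)

lemma cos_end_wronskian_deriv:
  "((\<lambda>t. fst (mathieu_cos s e) t * snd (mathieu_cos s' e') t - fst (mathieu_cos s' e') t * snd (mathieu_cos s e) t)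
     has_real_derivative (s' - s + (e' - e) * cos t) * (fst (mathieu_cos s e) t * fst (mathieu_cos s' e') t)) (at t)"
  using hill_wronskian_deriv[OF mathieu_cos(1)[unfolded mathieu_solution_def]
      mathieu_cos(1)[unfolded mathieu_solution_def], of s e s' e' t]
  by (simp add: algebra_simps)

lemma cos_end_ratio_lipschitz:
  assumes n: "near_resonance_point s e" "near_resonance_point s' e'"
  shows "\<bar>cos_end_ratio s e - cos_end_ratio s' e'\<bar> \<le> 16 * (\<bar>s - s'\<bar> + \<bar>e - e'\<bar>)"
proof -
  let ?L = "\<bar>s - s'\<bar> + \<bar>e - e'\<bar>"
  \<comment> \<open>The term \<open>1 * 0 - 1 * 0\<close> is the Wronskian at 0, written out to
    match the increment bound.\<close>
  have "\<bar>cos_end s e * cos_end_deriv s' e' - cos_end s' e' * cos_end_deriv s e - (1 * 0 - 1 * 0)\<bar>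
    \<le> (?L * (2 * 2)) * pi"
    unfolding cos_end_def cos_end_deriv_def
  proof (subst mathieu_cos(2)[of s e, symmetric], subst mathieu_cos(2)[of s' e', symmetric],
      subst mathieu_cos(3)[of s e, symmetric], subst mathieu_cos(3)[of s' e', symmetric],
      rule deriv_increment_bound[OF cos_end_wronskian_deriv])
    fix u assume u: "0 \<le> u" "u \<le> pi"
    have "\<bar>(e' - e) * cos u\<bar> \<le> \<bar>e - e'\<bar> * 1"
      unfolding abs_mult abs_minus_commute[of e'] by (intro mult_left_mono) auto
    then have 1: "\<bar>s' - s + (e' - e) * cos u\<bar> \<le> ?L"
      using abs_triangle_ineq[of "s' - s" "(e' - e) * cos u"] by (simp add: abs_minus_commute)
    show "\<bar>(s' - s + (e' - e) * cos u) * (fst (mathieu_cos s e) u * fst (mathieu_cos s' e') u)\<bar> \<le> ?L * (2 * 2)"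
      unfolding abs_mult[of "_ + _"] abs_mult[of "fst _ _"]
      by (intro mult_mono 1 mathieu_cos_near(1)[OF n(1)] mathieu_cos_near(1)[OF n(2)] u) auto
  qed simp
  also have "\<dots> \<le> (?L * (2 * 2)) * 4" using pi_less_4 by (intro mult_left_mono) auto
  finally have W: "\<bar>cos_end s e * cos_end_deriv s' e' - cos_end s' e' * cos_end_deriv s e\<bar> \<le> 16 * ?L" by simp
  have "1 * 1 \<le> cos_end_deriv s e * cos_end_deriv s' e'"
    using cos_end_near[OF n(1)] cos_end_near[OF n(2)] by (intro mult_mono) auto
  then have "\<bar>cos_end s e * cos_end_deriv s' e' - cos_end s' e' * cos_end_deriv s e\<bar>
      / (cos_end_deriv s e * cos_end_deriv s' e') \<le> 16 * ?L / 1"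
    by (intro frac_le W) auto
  then show ?thesis
    using cos_end_near[OF n(1)] cos_end_near[OF n(2)] unfolding cos_end_ratio_diff[OF n] by simp
qed

text \<open>The Wronskian at \<open>pi\<close> is \<open>s' - s\<close> times the integral of the
  product of the two solutions. Both are close to \<open>cos (3/2 * t)\<close>, whose square
  integrates to \<open>pi / 2\<close>, so the integral exceeds 1. The factor 4 bounds the product of
  the two slopes.\<close>

lemma cos_end_ratio_decreasing:
  assumes n: "near_resonance_point s e" "near_resonance_point s' e" and le: "s \<le> s'"
  shows "s' - s \<le> 4 * (cos_end_ratio s e - cos_end_ratio s' e)"
proof -
  let ?c = "fst (mathieu_cos s e)" and ?c' = "fst (mathieu_cos s' e)"
  define W where "W t = ?c t * snd (mathieu_cos s' e) t - ?c' t * snd (mathieu_cos s e) t" for t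
  have dW: "(W has_real_derivative (s' - s) * (?c t * ?c' t)) (at t)" for t
    using cos_end_wronskian_deriv[of s e s' e t] unfolding W_def by simp
  \<comment> \<open>The subtracted bracket is the antiderivative of
    \<open>(cos (3/2 * t))\<^sup>2\<close>, so \<open>f\<close> measures only the error of replacing
    both solutions by the cosine.\<close>
  define f where "f t = W t - (s' - s) * (t / 2 + sin (3 * t) / 6)" for t
  have dbl: "cos (3 * t) = 2 * (cos (3/2 * t))\<^sup>2 - 1" for t :: real
    using cos_double_cos[of "3/2 * t"] by simp
  have df: "(f has_real_derivative (s' - s) * (?c t * ?c' t - (cos (3/2 * t))\<^sup>2)) (at t)" for t
  proof -
    have "(f has_real_derivative (s' - s) * (?c t * ?c' t) - (s' - s) * (1 / 2 + cos (3 * t) * 3 / 6)) (at t)"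
      unfolding f_def by (auto intro!: derivative_eq_intros dW)
    moreover have "(s' - s) * (?c t * ?c' t) - (s' - s) * (1 / 2 + cos (3 * t) * 3 / 6) =
        (s' - s) * (?c t * ?c' t - (cos (3/2 * t))\<^sup>2)"
      unfolding dbl by algebra
    ultimately show ?thesis by simp
  qed
  have bound: "\<bar>f pi - f 0\<bar> \<le> ((s' - s) * (1/10)) * pi"
  proof (rule deriv_increment_bound[OF df])
    fix u assume u: "0 \<le> u" "u \<le> pi"
    define k where "k = cos (3/2 * u)"
    note m = mathieu_cos_near[OF n(1) u, folded k_def] mathieu_cos_near[OF n(2) u, folded k_def]
    have k: "\<bar>k\<bar> \<le> 1" unfolding k_def by simp
    have "\<bar>?c u * (?c' u - k)\<bar> \<le> 2 * (1/40)" "\<bar>k * (?c u - k)\<bar> \<le> 1 * (1/40)"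
      unfolding abs_mult by (intro mult_mono m k; simp)+
    moreover have "?c u * ?c' u - k\<^sup>2 = ?c u * (?c' u - k) + k * (?c u - k)" by algebra
    ultimately have "\<bar>?c u * ?c' u - k\<^sup>2\<bar> \<le> 1/10" by linarith
    then have "\<bar>(s' - s) * (?c u * ?c' u - k\<^sup>2)\<bar> \<le> (s' - s) * (1/10)"
      unfolding abs_mult using le by (intro mult_mono) auto
    then show "\<bar>(s' - s) * (?c u * ?c' u - (cos (3/2 * u))\<^sup>2)\<bar> \<le> (s' - s) * (1/10)"
      unfolding k_def .
  qed simp
  have "sin (3 * pi) = 0" using sin_npi[of 3] by simp
  then have "f pi - f 0 = W pi - (s' - s) * (pi / 2)" by (simp add: f_def W_def mathieu_cos)
  moreover have "((s' - s) * (1/10)) * pi = (s' - s) * (pi / 10)" by simp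
  ultimately have "W pi \<ge> (s' - s) * (pi / 2) - (s' - s) * (pi / 10)"
    using bound unfolding abs_le_iff by linarith
  moreover have "(s' - s) * 1 \<le> (s' - s) * (pi / 2 - pi / 10)"
    using pi_gt3 le by (intro mult_left_mono) auto
  ultimately have W: "s' - s \<le> W pi" by (simp add: algebra_simps)
  have "cos_end_deriv s e * cos_end_deriv s' e \<le> 2 * 2"
    using cos_end_near[OF n(1)] cos_end_near[OF n(2)] by (intro mult_mono) auto
  moreover have "0 < cos_end_deriv s e * cos_end_deriv s' e"
    using cos_end_near[OF n(1)] cos_end_near[OF n(2)] by (intro mult_pos_pos) auto
  ultimately have "(s' - s) / 4 \<le> W pi / (cos_end_deriv s e * cos_end_deriv s' e)"
    using W le by (intro frac_le) auto
  then have "(s' - s) / 4 \<le> cos_end_ratio s e - cos_end_ratio s' e"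
    unfolding cos_end_ratio_diff[OF n] W_def cos_end_def cos_end_deriv_def .
  then show ?thesis by (simp add: field_simps)
qed

section \<open>The resonance curve\<close>

text \<open>For \<open>\<bar>e\<bar> \<le> 1/100000\<close> the chosen zero exists by the
  intermediate value theorem and is unique because the ratio is strictly decreasing in
  \<open>s\<close>.\<close>

definition resonance_curve :: "real \<Rightarrow> real" where
  "resonance_curve e = (SOME s. \<bar>s + 9/4\<bar> \<le> 1/1000 \<and> cos_end_ratio s e = 0)"

lemma cos_end_ratio_resonance: "cos_end_ratio (-9/4) 0 = 0"
proof -
  have "\<bar>fst (mathieu_cos (-9/4) 0) pi - cos (3/2 * pi)\<bar> \<le> 11 * 0"
    by (rule near_resonance[OF mathieu_cos[unfolded mathieu_solution_def]]) auto
  then show ?thesis unfolding cos_three_halves_pi cos_end_ratio_def cos_end_def by simp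
qed

text \<open>At \<open>s = -9/4\<close> the ratio has size at most \<open>16 * \<bar>e\<bar>\<close>,
  while moving \<open>s\<close> by 1/1000 changes it by at least 1/4000. The range of
  \<open>e\<close> is small enough to force a sign change between the two ends.\<close>

lemma resonance_curve:
  assumes e: "\<bar>e\<bar> \<le> 1/100000"
  shows "near_resonance_point (resonance_curve e) e" "cos_end_ratio (resonance_curve e) e = 0"
proof -
  let ?l = "-9/4 - 1/1000 :: real" and ?m = "-9/4 :: real" and ?r = "-9/4 + 1/1000 :: real"
  have n: "near_resonance_point s e" if "s \<in> {?l..?r}" for s
  proof -
    have "?l \<le> s" "s \<le> ?r" using that by auto
    then have "\<bar>s + 9/4\<bar> \<le> 1/1000" by linarith
    then show ?thesis using e by (simp add: near_resonance_point_def)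
  qed
  have n0: "near_resonance_point ?m 0" by (simp add: near_resonance_point_def)
  have m: "\<bar>cos_end_ratio ?m e\<bar> \<le> 16 * \<bar>e\<bar>"
    using cos_end_ratio_lipschitz[OF n n0, of ?m] cos_end_ratio_resonance by simp
  have "?m - ?l \<le> 4 * (cos_end_ratio ?l e - cos_end_ratio ?m e)"
    "?r - ?m \<le> 4 * (cos_end_ratio ?m e - cos_end_ratio ?r e)"
    by (intro cos_end_ratio_decreasing n; simp)+
  with m e have sgn: "cos_end_ratio ?r e \<le> 0" "0 \<le> cos_end_ratio ?l e"
    unfolding right_diff_distrib by linarith+
  have "16-lipschitz_on {?l..?r} (\<lambda>s. cos_end_ratio s e)"
    by (rule lipschitz_onI) (use cos_end_ratio_lipschitz[OF n n] in \<open>auto simp: dist_real_def\<close>)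
  then have "continuous_on {?l..?r} (\<lambda>s. cos_end_ratio s e)"
    by (rule lipschitz_on_continuous_on)
  with sgn obtain s where "?l \<le> s" "s \<le> ?r" "cos_end_ratio s e = 0"
    using IVT2'[of "\<lambda>s. cos_end_ratio s e" ?r 0 ?l] by auto
  then have "\<exists>s. \<bar>s + 9/4\<bar> \<le> 1/1000 \<and> cos_end_ratio s e = 0"
    by (intro exI[of _ s] conjI) linarith+
  from someI_ex[OF this]
  show "near_resonance_point (resonance_curve e) e" "cos_end_ratio (resonance_curve e) e = 0"
    using e unfolding near_resonance_point_def resonance_curve_def by auto
qed

text \<open>This turns a small value of the ratio into a small distance from the resonance
  curve.\<close>

lemma cos_end_ratio_expanding:
  assumes n: "near_resonance_point s e" "near_resonance_point s' e"
  shows "\<bar>s - s'\<bar> \<le> 4 * \<bar>cos_end_ratio s e - cos_end_ratio s' e\<bar>"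
proof (cases "s \<le> s'")
  case True
  then show ?thesis using cos_end_ratio_decreasing[OF n True] True by argo
next
  case False
  then show ?thesis using cos_end_ratio_decreasing[OF n(2,1)] False by argo
qed

lemma resonance_curve_zero: "resonance_curve 0 = -9/4"
  using cos_end_ratio_expanding[OF resonance_curve(1), of 0 "-9/4"] resonance_curve(2)[of 0]
    cos_end_ratio_resonance
  by (simp add: near_resonance_point_def)

text \<open>The zero for \<open>e\<close> is an approximate zero for \<open>e'\<close>, with ratio
  at most \<open>16 * \<bar>e - e'\<bar>\<close>; the expansion estimate multiplies this by
  4.\<close>

lemma resonance_curve_lipschitz:
  assumes e: "\<bar>e\<bar> \<le> 1/100000" and e': "\<bar>e'\<bar> \<le> 1/100000"
  shows "\<bar>resonance_curve e - resonance_curve e'\<bar> \<le> 64 * \<bar>e - e'\<bar>"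
proof -
  have n: "near_resonance_point (resonance_curve e) e'"
    using resonance_curve(1)[OF e] e' by (simp add: near_resonance_point_def)
  show ?thesis
    using cos_end_ratio_expanding[OF n resonance_curve(1)[OF e']] resonance_curve(2)[OF e]
      resonance_curve(2)[OF e'] cos_end_ratio_lipschitz[OF n resonance_curve(1)[OF e]]
    by (simp add: abs_minus_commute)
qed

lemma continuous_on_resonance_curve: "continuous_on {-1/100000..1/100000} resonance_curve"
proof (rule lipschitz_on_continuous_on[of 64], rule lipschitz_onI)
  fix e e' :: real
  assume "e \<in> {-1/100000..1/100000}" "e' \<in> {-1/100000..1/100000}"
  then have "\<bar>e\<bar> \<le> 1/100000" "\<bar>e'\<bar> \<le> 1/100000" unfolding atLeastAtMost_iff by linarith+
  then show "dist (resonance_curve e) (resonance_curve e') \<le> 64 * dist e e'"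
    unfolding dist_real_def by (rule resonance_curve_lipschitz)
qed simp

lemma cos_end_sign:
  assumes e: "\<bar>e\<bar> \<le> 1/100000" and s: "\<bar>s + 9/4\<bar> \<le> 1/1000"
  shows "cos_end s e > 0 \<longleftrightarrow> s < resonance_curve e" "cos_end s e < 0 \<longleftrightarrow> s > resonance_curve e"
proof -
  have n: "near_resonance_point s e" using e s by (simp add: near_resonance_point_def)
  note r = resonance_curve[OF e]
  show "cos_end s e > 0 \<longleftrightarrow> s < resonance_curve e" "cos_end s e < 0 \<longleftrightarrow> s > resonance_curve e"
    unfolding cos_end_ratio_sign[OF n]
    using cos_end_ratio_decreasing[OF n r(1)] cos_end_ratio_decreasing[OF r(1) n] r(2)
    by (cases s "resonance_curve e" rule: linorder_cases; force)+
qed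

section \<open>Asymptotic expansion of the resonance curve\<close>

text \<open>Applied with \<open>x = e\<close> to the Fourier coefficients and with
  \<open>x = e ^ 6\<close> to the residuals, so only a sum of numerical coefficients has to be
  checked each time.\<close>

lemma quartic_mult_bound:
  fixes e x :: real
  assumes e: "\<bar>e\<bar> \<le> 1" and c: "\<bar>c0\<bar> + \<bar>c1\<bar> + \<bar>c2\<bar> + \<bar>c3\<bar> + \<bar>c4\<bar> \<le> 1"
  shows "\<bar>x * (c0 + c1 * e + c2 * e ^ 2 + c3 * e ^ 3 + c4 * e ^ 4)\<bar> \<le> \<bar>x\<bar>"
proof -
  have p: "\<bar>c * e ^ n\<bar> \<le> \<bar>c\<bar>" for c n
    using e by (simp add: abs_mult power_abs mult_left_le power_le_one)
  have "\<bar>c0 + c1 * e + c2 * e ^ 2 + c3 * e ^ 3 + c4 * e ^ 4\<bar> \<le> 1"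
    using p[of c1 1] p[of c2 2] p[of c3 3] p[of c4 4] c unfolding power_one_right by linarith
  then show ?thesis by (simp add: abs_mult mult_left_le)
qed

lemma cos_mult_cos_arith:
  fixes t k :: real
  shows "cos t * cos (k * t) = (cos ((k - 1) * t) + cos ((k + 1) * t)) / 2"
  by (simp add: algebra_simps cos_add cos_diff)

text \<open>The expansion of the lower curve with \<mu>/4 removed. Replacing \<open>e\<close> by
  \<open>- e\<close> flips the odd powers and gives the upper curve.\<close>

definition resonance_poly :: "real \<Rightarrow> real" where
  "resonance_poly e = -9/4 - 1/16 * e ^ 2 - 1/32 * e ^ 3 - 13/5120 * e ^ 4 + 5/2048 * e ^ 5"

lemma cos_sin_odd_half_pi:
  "cos (1/2 * pi) = 0" "cos (5/2 * pi) = 0" "cos (7/2 * pi) = 0" "cos (9/2 * pi) = 0"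
  "cos (11/2 * pi) = 0" "cos (13/2 * pi) = 0"
  "sin (1/2 * pi) = 1" "sin (5/2 * pi) = 1" "sin (7/2 * pi) = -1" "sin (9/2 * pi) = 1"
  "sin (11/2 * pi) = -1" "sin (13/2 * pi) = 1"
proof -
  have step: "cos ((k + 1) * pi) = - cos (k * pi)" "sin ((k + 1) * pi) = - sin (k * pi)" for k
    by (simp_all add: distrib_right)
  have 1: "cos (1/2 * pi) = 0" "sin (1/2 * pi) = 1" by simp_all
  have 5: "cos (5/2 * pi) = 0" "sin (5/2 * pi) = 1"
    using step[of "3/2"] cos_three_halves_pi by simp_all
  have 7: "cos (7/2 * pi) = 0" "sin (7/2 * pi) = -1" using step[of "5/2"] 5 by simp_all
  have 9: "cos (9/2 * pi) = 0" "sin (9/2 * pi) = 1" using step[of "7/2"] 7 by simp_all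
  have 11: "cos (11/2 * pi) = 0" "sin (11/2 * pi) = -1" using step[of "9/2"] 9 by simp_all
  have 13: "cos (13/2 * pi) = 0" "sin (13/2 * pi) = 1" using step[of "11/2"] 11 by simp_all
  show "cos (1/2 * pi) = 0" "cos (5/2 * pi) = 0" "cos (7/2 * pi) = 0" "cos (9/2 * pi) = 0"
    "cos (11/2 * pi) = 0" "cos (13/2 * pi) = 0"
    "sin (1/2 * pi) = 1" "sin (5/2 * pi) = 1" "sin (7/2 * pi) = -1" "sin (9/2 * pi) = 1"
    "sin (11/2 * pi) = -1" "sin (13/2 * pi) = 1"
    by (fact 1 5 7 9 11 13)+
qed

text \<open>Perturbation expansion in \<open>e\<close> of the antiperiodic even solution, as a Fourier cosine sum with
  coefficient \<open>1\<close> at the resonant frequency \<open>3/2\<close>; \<open>resonance_poly\<close> is what makes the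
  equation of that mode solvable to order \<open>5\<close>.\<close>

lemma mathieu_approximate_solution:
  assumes e': "\<bar>e\<bar> \<le> 1/100"
  obtains u u' u'' where
    "\<And>t. (u has_real_derivative u' t) (at t)" "\<And>t. (u' has_real_derivative u'' t) (at t)"
    "u' 0 = 0" "u pi = 0" "1 \<le> u' pi"
    "\<And>t. \<bar>u'' t - (resonance_poly e + e * cos t) * u t\<bar> \<le> 8 * \<bar>e ^ 6\<bar>"
proof -
  define s where "s = resonance_poly e"
  note s = s_def[unfolded resonance_poly_def]
  have e: "\<bar>e\<bar> \<le> 1" using e' by simp
  \<comment> \<open>Coefficients of \<open>cos ((k + 1/2) * t)\<close>, obtained by solving order by
    order in \<open>e\<close>. Zero terms are kept so that each has the shape of
    \<open>quartic_mult_bound\<close>.\<close>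
  define a0 where "a0 = e * (1/4 + 1/16 * e + 1/128 * e ^ 2 + (-1/256) * e ^ 3 + (-103/40960) * e ^ 4)"
  define a2 where "a2 = e * ((-1/8) + 0 * e + (-7/2560) * e ^ 2 + (-1/1024) * e ^ 3 + (-107/737280) * e ^ 4)"
  define a3 where "a3 = e * (0 + 1/160 * e + 0 * e ^ 2 + 17/92160 * e ^ 3 + 7/102400 * e ^ 4)"
  define a4 where "a4 = e * (0 + 0 * e + (-1/5760) * e ^ 2 + 0 * e ^ 3 + (-1/172032) * e ^ 4)"
  define a5 where "a5 = e * (0 + 0 * e + 0 * e ^ 2 + 1/322560 * e ^ 3 + 0 * e ^ 4)"
  define a6 where "a6 = e * (0 + 0 * e + 0 * e ^ 2 + 0 * e ^ 3 + (-1/25804800) * e ^ 4)"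

  \<comment> \<open>\<open>rk\<close> is the coefficient of \<open>cos ((k + 1/2) * t)\<close> in
    the residual. In \<open>r0\<close> the mode 1/2 couples to itself, since \<open>cos t\<close>
    reflects it to -1/2; \<open>r1\<close> is the solvability condition fixing \<open>s\<close>;
    \<open>r7\<close> is the mode created by truncation.\<close>
  define r0 where "r0 = - (1/4 + s) * a0 - e / 2 * (a0 + 1)"
  define r1 where "r1 = - (9/4 + s) - e / 2 * (a0 + a2)"
  define r2 where "r2 = - (25/4 + s) * a2 - e / 2 * (1 + a3)"
  define r3 where "r3 = - (49/4 + s) * a3 - e / 2 * (a2 + a4)"
  define r4 where "r4 = - (81/4 + s) * a4 - e / 2 * (a3 + a5)"
  define r5 where "r5 = - (121/4 + s) * a5 - e / 2 * (a4 + a6)"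
  define r6 where "r6 = - (169/4 + s) * a6 - e / 2 * (a5)"
  define r7 where "r7 = - e / 2 * (a6)"

  \<comment> \<open>Here and below all powers under \<open>e ^ 6\<close> cancel.\<close>
  have "r0 = e ^ 6 * (33/40960 + (-27/65536) * e + (-141/1310720) * e ^ 2 + 661/209715200 * e ^ 3 + 103/16777216 * e ^ 4)"
    unfolding r0_def s a0_def by (simp add: field_simps eval_nat_numeral)
  then have r0: "\<bar>r0\<bar> \<le> \<bar>e ^ 6\<bar>"
    by (simp only:) (rule quartic_mult_bound[OF e], simp)
  have "r1 = e ^ 6 * (1961/1474560 + 0 * e + 0 * e ^ 2 + 0 * e ^ 3 + 0 * e ^ 4)"
    unfolding r1_def s a0_def a2_def by (simp add: field_simps eval_nat_numeral)
  then have r1: "\<bar>r1\<bar> \<le> \<bar>e ^ 6\<bar>"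
    by (simp only:) (rule quartic_mult_bound[OF e], simp)
  have "r2 = e ^ 6 * (51/409600 + (-5489/117964800) * e + (-1/2949120) * e ^ 2 + 7609/3774873600 * e ^ 3 + 107/301989888 * e ^ 4)"
    unfolding r2_def s a2_def a3_def by (simp add: field_simps eval_nat_numeral)
  then have r2: "\<bar>r2\<bar> \<le> \<bar>e ^ 6\<bar>"
    by (simp only:) (rule quartic_mult_bound[OF e], simp)
  have "r3 = e ^ 6 * (5309/51609600 + (-77/14745600) * e + 1229/471859200 * e ^ 2 + (-653/2359296000) * e ^ 3 + (-7/41943040) * e ^ 4)"
    unfolding r3_def s a2_def a3_def a4_def by (simp add: field_simps eval_nat_numeral)
  then have r3: "\<bar>r3\<bar> \<le> \<bar>e ^ 6\<bar>"
    by (simp only:) (rule quartic_mult_bound[OF e], simp)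
  have "r4 = e ^ 6 * ((-73/1843200) + (-83/103219200) * e + 1/4128768 * e ^ 2 + (-13/880803840) * e ^ 3 + 5/352321536 * e ^ 4)"
    unfolding r4_def s a3_def a4_def a5_def by (simp add: field_simps eval_nat_numeral)
  then have r4: "\<bar>r4\<bar> \<le> \<bar>e ^ 6\<bar>"
    by (simp only:) (rule quartic_mult_bound[OF e], simp)
  have "r5 = e ^ 6 * (23/7372800 + 1/10321920 * e + 13/1651507200 * e ^ 2 + (-1/132120576) * e ^ 3 + 0 * e ^ 4)"
    unfolding r5_def s a4_def a5_def a6_def by (simp add: field_simps eval_nat_numeral)
  then have r5: "\<bar>r5\<bar> \<le> \<bar>e ^ 6\<bar>"
    by (simp only:) (rule quartic_mult_bound[OF e], simp)
  have "r6 = e ^ 6 * (0 + (-1/412876800) * e + (-1/825753600) * e ^ 2 + (-13/132120576000) * e ^ 3 + 1/10569646080 * e ^ 4)"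
    unfolding r6_def s a5_def a6_def by (simp add: field_simps eval_nat_numeral)
  then have r6: "\<bar>r6\<bar> \<le> \<bar>e ^ 6\<bar>"
    by (simp only:) (rule quartic_mult_bound[OF e], simp)
  have "r7 = e ^ 6 * (1/51609600 + 0 * e + 0 * e ^ 2 + 0 * e ^ 3 + 0 * e ^ 4)"
    unfolding r7_def s a6_def by (simp add: field_simps eval_nat_numeral)
  then have r7: "\<bar>r7\<bar> \<le> \<bar>e ^ 6\<bar>"
    by (simp only:) (rule quartic_mult_bound[OF e], simp)
  have a0: "\<bar>a0\<bar> \<le> \<bar>e\<bar>"
    unfolding a0_def by (rule quartic_mult_bound[OF e]) simp
  have a2: "\<bar>a2\<bar> \<le> \<bar>e\<bar>"
    unfolding a2_def by (rule quartic_mult_bound[OF e]) simp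
  have a3: "\<bar>a3\<bar> \<le> \<bar>e\<bar>"
    unfolding a3_def by (rule quartic_mult_bound[OF e]) simp
  have a4: "\<bar>a4\<bar> \<le> \<bar>e\<bar>"
    unfolding a4_def by (rule quartic_mult_bound[OF e]) simp
  have a5: "\<bar>a5\<bar> \<le> \<bar>e\<bar>"
    unfolding a5_def by (rule quartic_mult_bound[OF e]) simp
  have a6: "\<bar>a6\<bar> \<le> \<bar>e\<bar>"
    unfolding a6_def by (rule quartic_mult_bound[OF e]) simp
  define u where "u t = a0 * cos (1/2 * t) + cos (3/2 * t) + a2 * cos (5/2 * t) + a3 * cos (7/2 * t) + a4 * cos (9/2 * t) + a5 * cos (11/2 * t) + a6 * cos (13/2 * t)" for t
  define u' where "u' t = - (a0 * (1/2 * sin (1/2 * t)) + (3/2 * sin (3/2 * t)) + a2 * (5/2 * sin (5/2 * t)) + a3 * (7/2 * sin (7/2 * t)) + a4 * (9/2 * sin (9/2 * t)) + a5 * (11/2 * sin (11/2 * t)) + a6 * (13/2 * sin (13/2 * t)))" for t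
  define u'' where "u'' t = - (a0 * (1/4 * cos (1/2 * t)) + (9/4 * cos (3/2 * t)) + a2 * (25/4 * cos (5/2 * t)) + a3 * (49/4 * cos (7/2 * t)) + a4 * (81/4 * cos (9/2 * t)) + a5 * (121/4 * cos (11/2 * t)) + a6 * (169/4 * cos (13/2 * t)))" for t
  show thesis
  proof
    show "(u has_real_derivative u' t) (at t)" for t
      unfolding u_def u'_def by (auto intro!: derivative_eq_intros simp: algebra_simps)
    show "(u' has_real_derivative u'' t) (at t)" for t
      unfolding u'_def u''_def by (auto intro!: derivative_eq_intros simp: algebra_simps)
    show "u' 0 = 0" by (simp add: u'_def)
    show "u pi = 0" unfolding u_def cos_three_halves_pi cos_sin_odd_half_pi by simp
    \<comment> \<open>The resonant mode contributes 3/2; the other frequencies add up to 23, so with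
      \<open>\<bar>e\<bar> \<le> 1/100\<close> the rest is at most 0.23.\<close>
    show "1 \<le> u' pi" using a0 a2 a3 a4 a5 a6 e'
      unfolding u'_def cos_three_halves_pi cos_sin_odd_half_pi by (simp add: abs_le_iff)
    fix t :: real
    define k0 where "k0 = cos (1/2 * t)"
    define k1 where "k1 = cos (3/2 * t)"
    define k2 where "k2 = cos (5/2 * t)"
    define k3 where "k3 = cos (7/2 * t)"
    define k4 where "k4 = cos (9/2 * t)"
    define k5 where "k5 = cos (11/2 * t)"
    define k6 where "k6 = cos (13/2 * t)"
    define k7 where "k7 = cos (15/2 * t)"
    have m0: "cos t * k0 = (k0 + k1) / 2"
      using cos_mult_cos_arith[of t "1/2"] unfolding k0_def k0_def k1_def by simp
    have m1: "cos t * k1 = (k0 + k2) / 2"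
      using cos_mult_cos_arith[of t "3/2"] unfolding k1_def k0_def k2_def by simp
    have m2: "cos t * k2 = (k1 + k3) / 2"
      using cos_mult_cos_arith[of t "5/2"] unfolding k2_def k1_def k3_def by simp
    have m3: "cos t * k3 = (k2 + k4) / 2"
      using cos_mult_cos_arith[of t "7/2"] unfolding k3_def k2_def k4_def by simp
    have m4: "cos t * k4 = (k3 + k5) / 2"
      using cos_mult_cos_arith[of t "9/2"] unfolding k4_def k3_def k5_def by simp
    have m5: "cos t * k5 = (k4 + k6) / 2"
      using cos_mult_cos_arith[of t "11/2"] unfolding k5_def k4_def k6_def by simp
    have m6: "cos t * k6 = (k5 + k7) / 2"
      using cos_mult_cos_arith[of t "13/2"] unfolding k6_def k5_def k7_def by simp
    have u: "u t = a0 * k0 + k1 + a2 * k2 + a3 * k3 + a4 * k4 + a5 * k5 + a6 * k6"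
      unfolding u_def k0_def k1_def k2_def k3_def k4_def k5_def k6_def by simp
    have Qu: "(s + e * cos t) * u t = s * u t + e * (a0 * (cos t * k0) + (cos t * k1) + a2 * (cos t * k2) + a3 * (cos t * k3) + a4 * (cos t * k4) + a5 * (cos t * k5) + a6 * (cos t * k6))"
      unfolding u by algebra
    have "u'' t - (s + e * cos t) * u t =
      r0 * k0 + r1 * k1 + r2 * k2 + r3 * k3 + r4 * k4 + r5 * k5 + r6 * k6 + r7 * k7"
      unfolding Qu unfolding m0 m1 m2 m3 m4 m5 m6 u u''_def k0_def[symmetric] k1_def[symmetric] k2_def[symmetric] k3_def[symmetric] k4_def[symmetric] k5_def[symmetric] k6_def[symmetric]
        r0_def r1_def r2_def r3_def r4_def r5_def r6_def r7_def by (simp add: field_simps)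
    moreover have b0: "\<bar>r0 * k0\<bar> \<le> \<bar>e ^ 6\<bar>"
      using r0 mult_mono[of "\<bar>r0\<bar>" "\<bar>e ^ 6\<bar>" "\<bar>k0\<bar>" 1] unfolding k0_def abs_mult by simp
    moreover have b1: "\<bar>r1 * k1\<bar> \<le> \<bar>e ^ 6\<bar>"
      using r1 mult_mono[of "\<bar>r1\<bar>" "\<bar>e ^ 6\<bar>" "\<bar>k1\<bar>" 1] unfolding k1_def abs_mult by simp
    moreover have b2: "\<bar>r2 * k2\<bar> \<le> \<bar>e ^ 6\<bar>"
      using r2 mult_mono[of "\<bar>r2\<bar>" "\<bar>e ^ 6\<bar>" "\<bar>k2\<bar>" 1] unfolding k2_def abs_mult by simp
    moreover have b3: "\<bar>r3 * k3\<bar> \<le> \<bar>e ^ 6\<bar>"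
      using r3 mult_mono[of "\<bar>r3\<bar>" "\<bar>e ^ 6\<bar>" "\<bar>k3\<bar>" 1] unfolding k3_def abs_mult by simp
    moreover have b4: "\<bar>r4 * k4\<bar> \<le> \<bar>e ^ 6\<bar>"
      using r4 mult_mono[of "\<bar>r4\<bar>" "\<bar>e ^ 6\<bar>" "\<bar>k4\<bar>" 1] unfolding k4_def abs_mult by simp
    moreover have b5: "\<bar>r5 * k5\<bar> \<le> \<bar>e ^ 6\<bar>"
      using r5 mult_mono[of "\<bar>r5\<bar>" "\<bar>e ^ 6\<bar>" "\<bar>k5\<bar>" 1] unfolding k5_def abs_mult by simp
    moreover have b6: "\<bar>r6 * k6\<bar> \<le> \<bar>e ^ 6\<bar>"
      using r6 mult_mono[of "\<bar>r6\<bar>" "\<bar>e ^ 6\<bar>" "\<bar>k6\<bar>" 1] unfolding k6_def abs_mult by simp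
    moreover have b7: "\<bar>r7 * k7\<bar> \<le> \<bar>e ^ 6\<bar>"
      using r7 mult_mono[of "\<bar>r7\<bar>" "\<bar>e ^ 6\<bar>" "\<bar>k7\<bar>" 1] unfolding k7_def abs_mult by simp
    ultimately show "\<bar>u'' t - (resonance_poly e + e * cos t) * u t\<bar> \<le> 8 * \<bar>e ^ 6\<bar>"
      unfolding s_def by linarith
  qed
qed

text \<open>The Wronskian of the exact even solution with the approximate one vanishes at 0 and
  drifts by at most \<open>64 * \<bar>e ^ 6\<bar>\<close> up to \<open>pi\<close>. There it equals
  \<open>c pi * u' pi\<close> with \<open>u' pi\<close> at least 1, so \<open>cos_end\<close> is
  that small at \<open>resonance_poly e\<close>; the expansion estimate contributes the last factor
  4.\<close>

lemma resonance_curve_asymptotic: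
  assumes e: "\<bar>e\<bar> \<le> 1/100000"
  shows "\<bar>resonance_curve e - resonance_poly e\<bar> \<le> 256 * \<bar>e ^ 6\<bar>"
proof -
  define s where "s = resonance_poly e"
  have "\<bar>e * (0 + (- 1/16) * e + (- 1/32) * e ^ 2 + (- 13/5120) * e ^ 3 + 5/2048 * e ^ 4)\<bar> \<le> \<bar>e\<bar>"
    by (rule quartic_mult_bound) (use e in auto)
  moreover have "e * (0 + (- 1/16) * e + (- 1/32) * e ^ 2 + (- 13/5120) * e ^ 3 + 5/2048 * e ^ 4) = s + 9/4"
    unfolding s_def resonance_poly_def by algebra
  ultimately have n: "near_resonance_point s e"
    using e by (simp add: near_resonance_point_def)
  have "\<bar>e\<bar> \<le> 1/100" using e by simp
  from mathieu_approximate_solution[OF this] obtain u u' u'' where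
    u: "\<And>t. (u has_real_derivative u' t) (at t)" "\<And>t. (u' has_real_derivative u'' t) (at t)"
    "u' 0 = 0" "u pi = 0" "1 \<le> u' pi"
    "\<And>t. \<bar>u'' t - (s + e * cos t) * u t\<bar> \<le> 8 * \<bar>e ^ 6\<bar>"
    unfolding s_def by blast
  define c where "c = fst (mathieu_cos s e)"
  define c' where "c' = snd (mathieu_cos s e)"
  have c: "(c has_real_derivative c' t) (at t)"
    "(c' has_real_derivative (s + e * cos t) * c t) (at t)" for t
    using mathieu_cos(1)[of s e] by (auto simp: mathieu_solution_def hill_solution_def c_def c'_def)
  have D: "((\<lambda>t. c t * u' t - u t * c' t) has_real_derivative
      c t * (u'' t - (s + e * cos t) * u t)) (at t)" for t
    by (auto intro!: derivative_eq_intros c u simp: algebra_simps)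
  have "\<bar>(c pi * u' pi - u pi * c' pi) - (c 0 * u' 0 - u 0 * c' 0)\<bar> \<le> (2 * (8 * \<bar>e ^ 6\<bar>)) * pi"
  proof (rule deriv_increment_bound[OF D])
    fix t assume t: "0 \<le> t" "t \<le> pi"
    show "\<bar>c t * (u'' t - (s + e * cos t) * u t)\<bar> \<le> 2 * (8 * \<bar>e ^ 6\<bar>)"
      unfolding c_def abs_mult[of "fst _ _"]
      by (intro mult_mono u(6) mathieu_cos_near(1)[OF n t]) auto
  qed simp
  also have "\<dots> \<le> (2 * (8 * \<bar>e ^ 6\<bar>)) * 4" using pi_less_4 by (intro mult_left_mono) auto
  finally have "\<bar>c pi * u' pi\<bar> \<le> 64 * \<bar>e ^ 6\<bar>"
    using u(3,4) by (simp add: c'_def mathieu_cos(3))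
  moreover have "\<bar>c pi\<bar> * 1 \<le> \<bar>c pi\<bar> * \<bar>u' pi\<bar>" using u(5) by (intro mult_left_mono) auto
  ultimately have F: "\<bar>cos_end s e\<bar> \<le> 64 * \<bar>e ^ 6\<bar>" by (simp add: cos_end_def c_def abs_mult)
  have "\<bar>cos_end_ratio s e\<bar> \<le> \<bar>cos_end s e\<bar> / 1"
    unfolding cos_end_ratio_def abs_divide using cos_end_near[OF n] by (intro frac_le) auto
  then show ?thesis
    using F cos_end_ratio_expanding[OF resonance_curve(1)[OF e] n] resonance_curve(2)[OF e]
    unfolding s_def by simp
qed

section \<open>The boundary of the stability region\<close>

text \<open>By \<open>cos_end_sign\<close> the factors \<open>cos_end s \<epsilon>\<close> and
  \<open>cos_end s (- \<epsilon>)\<close> have opposite signs strictly between the curves and equal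
  signs outside, whichever curve is the lower one.\<close>

lemma boundary_resonance_curve:
  "boundary_emanating_from (\<lambda>\<alpha> \<epsilon>. stable_system (pendulum_H \<mu> \<alpha> \<epsilon>)) ((\<mu> - 9) / 4)
     (\<lambda>\<epsilon>. \<mu> / 4 + resonance_curve \<epsilon>) (\<lambda>\<epsilon>. \<mu> / 4 + resonance_curve (- \<epsilon>))"
  unfolding boundary_emanating_from_def
proof (rule exI[of _ "1/100000"], intro conjI exI[of _ "1/1000"] allI impI)
  show "continuous_on {0..<1/100000} (\<lambda>\<epsilon>. \<mu> / 4 + resonance_curve \<epsilon>)"
    "continuous_on {0..<1/100000} (\<lambda>\<epsilon>. \<mu> / 4 + resonance_curve (- \<epsilon>))"
    by (intro continuous_intros continuous_on_compose2[OF continuous_on_resonance_curve]; auto)+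
  show "\<mu> / 4 + resonance_curve 0 = (\<mu> - 9) / 4" "\<mu> / 4 + resonance_curve (- 0) = (\<mu> - 9) / 4"
    by (simp_all add: resonance_curve_zero field_simps)
  fix \<epsilon> \<alpha> :: real
  assume a: "0 < \<epsilon> \<and> \<epsilon> < 1/100000 \<and> \<bar>\<alpha> - (\<mu> - 9) / 4\<bar> < 1/1000"
  define s where "s = \<alpha> - \<mu> / 4"
  have "\<alpha> - (\<mu> - 9) / 4 = s + 9/4" by (simp add: s_def field_simps)
  with a have s: "\<bar>s + 9/4\<bar> \<le> 1/1000" and e: "\<bar>\<epsilon>\<bar> \<le> 1/100000" "\<bar>- \<epsilon>\<bar> \<le> 1/100000" by auto
  note sgn = cos_end_sign[OF e(1) s] cos_end_sign[OF e(2) s]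
  show "\<not> stable_system (pendulum_H \<mu> \<alpha> \<epsilon>)"
    if "\<alpha> \<in> open_segment (\<mu> / 4 + resonance_curve \<epsilon>) (\<mu> / 4 + resonance_curve (- \<epsilon>))"
  proof (rule not_stable_system_pendulum[OF _ s_def])
    show "cos_end s \<epsilon> * cos_end s (- \<epsilon>) < 0"
      using that sgn unfolding s_def open_segment_eq_real_ivl mult_less_0_iff
      by (auto split: if_splits)
  qed
  show "stable_system (pendulum_H \<mu> \<alpha> \<epsilon>)"
    if "\<alpha> \<notin> closed_segment (\<mu> / 4 + resonance_curve \<epsilon>) (\<mu> / 4 + resonance_curve (- \<epsilon>))"
  proof (rule stable_system_pendulum[OF _ _ s_def])
    show "0 < cos_end s \<epsilon> * cos_end s (- \<epsilon>)"
      using that sgn unfolding s_def closed_segment_eq_real_ivl zero_less_mult_iff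
      by (auto split: if_splits)
    have "near_resonance_point s \<epsilon>" "near_resonance_point s (- \<epsilon>)"
      using s e by (auto simp: near_resonance_point_def)
    then have "\<bar>cos_end s \<epsilon> * cos_end s (- \<epsilon>)\<bar> \<le> 1/40 * (1/40)"
      unfolding abs_mult by (intro mult_mono cos_end_near) auto
    then show "cos_end s \<epsilon> * cos_end s (- \<epsilon>) < 1" by linarith
  qed
qed simp_all

theorem mainTheorem6:
  "\<exists>\<alpha>\<^sub>m \<alpha>\<^sub>p :: real \<Rightarrow> real \<Rightarrow> real. \<forall>\<mu>.
     boundary_emanating_from (\<lambda>\<alpha> \<epsilon>. stable_system (pendulum_H \<mu> \<alpha> \<epsilon>))
       ((\<mu> - 9) / 4) (\<alpha>\<^sub>m \<mu>) (\<alpha>\<^sub>p \<mu>) \<and>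
     (\<lambda>\<epsilon>. \<alpha>\<^sub>m \<mu> \<epsilon> - ((\<mu> - 9) / 4 - 1/16 * \<epsilon>^2 - 1/32 * \<epsilon>^3 - 13/5120 * \<epsilon>^4 + 5/2048 * \<epsilon>^5))
       \<in> O[at_right 0](\<lambda>\<epsilon>. \<epsilon>^6) \<and>
     (\<lambda>\<epsilon>. \<alpha>\<^sub>p \<mu> \<epsilon> - ((\<mu> - 9) / 4 - 1/16 * \<epsilon>^2 + 1/32 * \<epsilon>^3 - 13/5120 * \<epsilon>^4 - 5/2048 * \<epsilon>^5))
       \<in> O[at_right 0](\<lambda>\<epsilon>. \<epsilon>^6)"
proof (intro exI allI conjI)
  fix \<mu> :: real
  have near: "\<forall>\<^sub>F \<epsilon> in at_right 0. \<bar>\<epsilon>\<bar> \<le> 1/100000 \<and> \<bar>- \<epsilon>\<bar> \<le> (1/100000 :: real)"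
    by (rule eventually_at_rightI[of 0 "1/100000"]) auto
  \<comment> \<open>This fixes the witnesses: one function \<open>resonance_curve\<close> serves
    both curves, evaluated at \<open>\<epsilon>\<close> and at \<open>- \<epsilon>\<close>.\<close>
  show "boundary_emanating_from (\<lambda>\<alpha> \<epsilon>. stable_system (pendulum_H \<mu> \<alpha> \<epsilon>)) ((\<mu> - 9) / 4)
     (\<lambda>\<epsilon>. \<mu> / 4 + resonance_curve \<epsilon>) (\<lambda>\<epsilon>. \<mu> / 4 + resonance_curve (- \<epsilon>))"
    by (rule boundary_resonance_curve)
  show "(\<lambda>\<epsilon>. \<mu> / 4 + resonance_curve \<epsilon>
      - ((\<mu> - 9) / 4 - 1/16 * \<epsilon>^2 - 1/32 * \<epsilon>^3 - 13/5120 * \<epsilon>^4 + 5/2048 * \<epsilon>^5))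
    \<in> O[at_right 0](\<lambda>\<epsilon>. \<epsilon>^6)"
  proof (rule bigoI[of _ 256], rule eventually_mono[OF near])
    fix \<epsilon> :: real assume "\<bar>\<epsilon>\<bar> \<le> 1/100000 \<and> \<bar>- \<epsilon>\<bar> \<le> 1/100000"
    then show "norm (\<mu> / 4 + resonance_curve \<epsilon>
        - ((\<mu> - 9) / 4 - 1/16 * \<epsilon>^2 - 1/32 * \<epsilon>^3 - 13/5120 * \<epsilon>^4 + 5/2048 * \<epsilon>^5)) \<le> 256 * norm (\<epsilon>^6)"
      using resonance_curve_asymptotic[of \<epsilon>] unfolding resonance_poly_def
      by (simp add: diff_divide_distrib algebra_simps)
  qed
  show "(\<lambda>\<epsilon>. \<mu> / 4 + resonance_curve (- \<epsilon>)
      - ((\<mu> - 9) / 4 - 1/16 * \<epsilon>^2 + 1/32 * \<epsilon>^3 - 13/5120 * \<epsilon>^4 - 5/2048 * \<epsilon>^5))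
    \<in> O[at_right 0](\<lambda>\<epsilon>. \<epsilon>^6)"
  proof (rule bigoI[of _ 256], rule eventually_mono[OF near])
    fix \<epsilon> :: real assume "\<bar>\<epsilon>\<bar> \<le> 1/100000 \<and> \<bar>- \<epsilon>\<bar> \<le> 1/100000"
    then show "norm (\<mu> / 4 + resonance_curve (- \<epsilon>)
        - ((\<mu> - 9) / 4 - 1/16 * \<epsilon>^2 + 1/32 * \<epsilon>^3 - 13/5120 * \<epsilon>^4 - 5/2048 * \<epsilon>^5)) \<le> 256 * norm (\<epsilon>^6)"
      using resonance_curve_asymptotic[of "- \<epsilon>"] unfolding resonance_poly_def
      by (simp add: diff_divide_distrib algebra_simps)
  qed
qed

end
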